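(* Assume $0<\min_{1\le\ell\le L}\rho_{\ell-1,\ell}\le\max_{1\le\ell\le L}\rho_{\ell-1,\ell}<1$ (with $\rho_{0,1}=\rho$), $D(f_1,f_0)<\infty$, and that for every $\ell\in\{2,\dots,L\}$ there exists $j$ with $\ell\le j\le L$ such that $$D(f_1,f_0)>\frac{1}{j-\ell+1}\log\left(\frac{\sum_{p=0}^{\ell-1}(1-\rho_{p,p+1})}{1-\rho_{j,j+1}}\right)$$ (where $\rho_{L,L+1}=0$). Then $\limsup_{A\to\infty}E[\nu_A]/A\le 1/\big(L D(f_1,f_0)+|\log(1-\rho)|\big)$, and the test $\nu_A$ with $A=\log\frac{1}{\rho\alpha}$ belongs to $\Delta_\alpha$ and is asymptotically optimal as $\alpha\to0$: $$E_{\sf DD}(\nu_A)\le\frac{\log(1/\rho)+|\log\alpha|}{L D(f_1,f_0)+|\log(1-\rho)|}\,(1+o(1)),$$ which matches the lower bound $\inf_{\tau\in\Delta_\alpha}E_{\sf DD}(\tau)\ge\frac{\log(1/(\rho\alpha))}{LD(f_1,f_0)+|\log(1-\rho)|}(1+o(1))$.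
   Context: Model. Fix an integer $L\ge1$, $\rho\in(0,1)$ and $\rho_{\ell-1,\ell}\in[0,1]$ ($\ell=2,\dots,L$); put $\rho_{0,1}=\rho$, $\rho_{L,L+1}=0$. Change-points: $P(\Gamma_1=m)=\rho(1-\rho)^m$, $m\ge0$; $\Gamma_\ell=\Gamma_{\ell-1}+G_\ell$ with $G_2,\dots,G_L$ independent of each other and of $\Gamma_1$, $P(G_\ell=m)=\rho_{\ell-1,\ell}(1-\rho_{\ell-1,\ell})^m$. $f_0,f_1$ are mutually absolutely continuous densities, $D(f_1,f_0)=\int f_1\log(f_1/f_0)$. Conditionally on the change-points, the observations $Z_{k,\ell}$ ($k\ge1$, $1\le\ell\le L$) are independent with density $f_0$ if $k<\Gamma_\ell$ and $f_1$ if $k\ge\Gamma_\ell$. With $p_{k,\ell}=P(\Gamma_1\le k,\dots,\Gamma_{\ell-1}\le k,\Gamma_\ell>k,\dots,\Gamma_L>k\mid\mathbf Z_1,\dots,\mathbf Z_k)$, $\ell=1,\dots,L+1$, put $q_{k,\ell}=p_{k,\ell}/(\rho p_{k,1})$ and $\nu_A=\inf\{k\ge0:\log\sum_{\ell=2}^{L+1}q_{k,\ell}\ge A\}$. $E_{\sf DD}(\tau)=E[(\tau-\Gamma_1)^+]$ and $\Delta_\alpha=\{\tau:P(\tau<\Gamma_1)\le\alpha\}$. *)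

theory Defs
  imports "HOL-Probability.Probability"
begin

text \<open>Parameters: L streams; rho l = \<rho>_{l-1,l} for l = 1..L (so rho 1 = \<rho>);
  observations take values in a measure space N, f0 f1 are densities w.r.t. N.\<close>

definition rho_pp :: "nat \<Rightarrow> (nat \<Rightarrow> real) \<Rightarrow> nat \<Rightarrow> real" where
  "rho_pp L rho p = (if p < L then rho (Suc p) else 0)"

text \<open>Joint law of the change-points (\<Gamma>_1,...,\<Gamma>_n) as a function l \<mapsto> \<Gamma>_l:
  \<Gamma>_1 ~ Geom(\<rho>_{0,1}), \<Gamma>_l = \<Gamma>_{l-1} + G_l with G_l ~ Geom(\<rho>_{l-1,l}) independent.\<close>
primrec cp_pmf :: "nat \<Rightarrow> (nat \<Rightarrow> real) \<Rightarrow> (nat \<Rightarrow> nat) pmf" where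
  "cp_pmf 0 rho = return_pmf (\<lambda>_. 0)"
| "cp_pmf (Suc n) rho =
     bind_pmf (cp_pmf n rho)
       (\<lambda>g. map_pmf (\<lambda>d. g(Suc n := (if n = 0 then 0 else g n) + d)) (geometric_pmf (rho (Suc n))))"

definition obs_meas :: "'a measure \<Rightarrow> ('a \<Rightarrow> real) \<Rightarrow> ('a \<Rightarrow> real) \<Rightarrow> (nat \<Rightarrow> nat)
    \<Rightarrow> (nat \<times> nat \<Rightarrow> 'a) measure" where
  "obs_meas N f0 f1 g =
     PiM UNIV (\<lambda>(k, l). density N (\<lambda>x. ennreal (if k < g l then f0 x else f1 x)))"

definition model :: "nat \<Rightarrow> (nat \<Rightarrow> real) \<Rightarrow> 'a measure \<Rightarrow> ('a \<Rightarrow> real) \<Rightarrow> ('a \<Rightarrow> real)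
    \<Rightarrow> ((nat \<Rightarrow> nat) \<times> (nat \<times> nat \<Rightarrow> 'a)) measure" where
  "model L rho N f0 f1 =
     measure_pmf (cp_pmf L rho) \<bind>
       (\<lambda>g. distr (obs_meas N f0 f1 g) (count_space UNIV \<Otimes>\<^sub>M PiM UNIV (\<lambda>_. N)) (\<lambda>z. (g, z)))"

definition obs_filt :: "nat \<Rightarrow> (nat \<Rightarrow> real) \<Rightarrow> 'a measure \<Rightarrow> ('a \<Rightarrow> real) \<Rightarrow> ('a \<Rightarrow> real)
    \<Rightarrow> nat \<Rightarrow> ((nat \<Rightarrow> nat) \<times> (nat \<times> nat \<Rightarrow> 'a)) measure" where
  "obs_filt L rho N f0 f1 k =
     vimage_algebra (space (model L rho N f0 f1))
       (\<lambda>\<omega>. restrict (snd \<omega>) ({1..k} \<times> {1..L})) (PiM ({1..k} \<times> {1..L}) (\<lambda>_. N))"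

definition cp_event :: "nat \<Rightarrow> nat \<Rightarrow> nat \<Rightarrow> ((nat \<Rightarrow> nat) \<times> (nat \<times> nat \<Rightarrow> 'a)) set" where
  "cp_event L k l = {\<omega>. (\<forall>i\<in>{1..<l}. fst \<omega> i \<le> k) \<and> (\<forall>i\<in>{l..L}. fst \<omega> i > k)}"

definition post :: "nat \<Rightarrow> (nat \<Rightarrow> real) \<Rightarrow> 'a measure \<Rightarrow> ('a \<Rightarrow> real) \<Rightarrow> ('a \<Rightarrow> real)
    \<Rightarrow> nat \<Rightarrow> nat \<Rightarrow> ((nat \<Rightarrow> nat) \<times> (nat \<times> nat \<Rightarrow> 'a)) \<Rightarrow> real" where
  "post L rho N f0 f1 k l =
     real_cond_exp (model L rho N f0 f1) (obs_filt L rho N f0 f1 k) (indicator (cp_event L k l))"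

definition qstat :: "nat \<Rightarrow> (nat \<Rightarrow> real) \<Rightarrow> 'a measure \<Rightarrow> ('a \<Rightarrow> real) \<Rightarrow> ('a \<Rightarrow> real)
    \<Rightarrow> nat \<Rightarrow> nat \<Rightarrow> ((nat \<Rightarrow> nat) \<times> (nat \<times> nat \<Rightarrow> 'a)) \<Rightarrow> real" where
  "qstat L rho N f0 f1 k l \<omega> = post L rho N f0 f1 k l \<omega> / (rho 1 * post L rho N f0 f1 k 1 \<omega>)"

definition nu :: "nat \<Rightarrow> (nat \<Rightarrow> real) \<Rightarrow> 'a measure \<Rightarrow> ('a \<Rightarrow> real) \<Rightarrow> ('a \<Rightarrow> real)
    \<Rightarrow> real \<Rightarrow> ((nat \<Rightarrow> nat) \<times> (nat \<times> nat \<Rightarrow> 'a)) \<Rightarrow> enat" where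
  "nu L rho N f0 f1 A \<omega> =
     (let S = {k. ln (\<Sum>l=2..L+1. qstat L rho N f0 f1 k l \<omega>) \<ge> A}
      in if S = {} then \<infinity> else enat (LEAST k. k \<in> S))"

definition obs_stopping_time :: "nat \<Rightarrow> (nat \<Rightarrow> real) \<Rightarrow> 'a measure \<Rightarrow> ('a \<Rightarrow> real) \<Rightarrow> ('a \<Rightarrow> real)
    \<Rightarrow> (((nat \<Rightarrow> nat) \<times> (nat \<times> nat \<Rightarrow> 'a)) \<Rightarrow> enat) \<Rightarrow> bool" where
  "obs_stopping_time L rho N f0 f1 \<tau> \<longleftrightarrow>
     (\<forall>k::nat. {\<omega> \<in> space (model L rho N f0 f1). \<tau> \<omega> \<le> enat k} \<in> sets (obs_filt L rho N f0 f1 k))"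

definition Delta :: "nat \<Rightarrow> (nat \<Rightarrow> real) \<Rightarrow> 'a measure \<Rightarrow> ('a \<Rightarrow> real) \<Rightarrow> ('a \<Rightarrow> real)
    \<Rightarrow> real \<Rightarrow> (((nat \<Rightarrow> nat) \<times> (nat \<times> nat \<Rightarrow> 'a)) \<Rightarrow> enat) set" where
  "Delta L rho N f0 f1 \<alpha> =
     {\<tau>. obs_stopping_time L rho N f0 f1 \<tau> \<and>
          measure (model L rho N f0 f1) {\<omega> \<in> space (model L rho N f0 f1). \<tau> \<omega> < enat (fst \<omega> 1)} \<le> \<alpha>}"

definition EDD :: "nat \<Rightarrow> (nat \<Rightarrow> real) \<Rightarrow> 'a measure \<Rightarrow> ('a \<Rightarrow> real) \<Rightarrow> ('a \<Rightarrow> real)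
    \<Rightarrow> (((nat \<Rightarrow> nat) \<times> (nat \<times> nat \<Rightarrow> 'a)) \<Rightarrow> enat) \<Rightarrow> ennreal" where
  "EDD L rho N f0 f1 \<tau> =
     (\<integral>\<^sup>+ \<omega>. ennreal_of_enat (\<tau> \<omega> - enat (fst \<omega> 1)) \<partial>model L rho N f0 f1)"

definition KL :: "'a measure \<Rightarrow> ('a \<Rightarrow> real) \<Rightarrow> ('a \<Rightarrow> real) \<Rightarrow> real" where
  "KL N f1 f0 = (\<integral>x. f1 x * ln (f1 x / f0 x) \<partial>N)"

end

theory Submission
  imports Defs
begin

text \<open>
  Upper bound. Let \<open>m = max \<Gamma>\<^sub>L 1\<close>. From time \<open>m\<close> on all streams have density \<open>f1\<close>, and Bayes' rule
  applied to the single hypothesis that all streams change at \<open>m\<close> bounds the log-statistic at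
  time \<open>k\<close> from below by a constant plus a random walk of \<open>k + 1 - m\<close> i.i.d. steps with drift
  \<open>L D + \<bar>ln (1 - \<rho>)\<bar>\<close>. Truncating the steps from above and using Wald's identity bounds the
  expected crossing time of level \<open>A\<close> by \<open>A / c' + const\<close> for every \<open>c'\<close> below the drift.

  Lower bound. If no change has occurred before \<open>m\<close>, a test in \<open>\<Delta>\<^sub>\<alpha>\<close> stops before \<open>m\<close> with
  probability at most \<open>\<alpha> / (1 - \<rho>) ^ m\<close>. The change of measure to the law given the change-points costs
  at most a factor \<open>exp (K (L D + \<epsilon>))\<close> for \<open>m = \<Gamma>\<^sub>1 + K\<close>, up to a weak-law error that is uniform in
  the change-points.
\<close>

section \<open>Model and likelihood ratios\<close>

text \<open>The simultaneous change at \<open>m\<close> has prior mass at least a constant times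
  \<open>(1 - rho 1) ^ m\<close>, while "no change by time \<open>k\<close>" has probability
  \<open>(1 - rho 1) ^ Suc k\<close>. The quotient of the two powers is what adds |ln (1 - \<rho>)|
  per step to the drift; ignoring every other configuration costs only the constant
  \<open>ln C0\<close>, which vanishes after division by the level. With \<open>D\<close> merely
  finite there is no second moment to control the overshoot of the walk. Truncation bounds the
  overshoot by a constant, and a high truncation point lowers the drift as little as desired. In the
  lower bound the factor \<open>(1 - rho 1) ^ - m\<close> is unbounded in \<Gamma>_1, so the
  configurations with \<Gamma>_1 > \<open>G\<close> are given up; \<open>G\<close> is fixed before
  \<alpha> tends to 0. The number of cells observed after their change varies with the
  change-points, which is why the weak law must be uniform. Posteriors are only versions of
  conditional expectations and \<open>qstat\<close> divides by one of them, so positivity, total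
  mass 1 and Bayes' rule hold almost everywhere, simultaneously for the countably many
  times.\<close>

lemma density_PiM:
  fixes M :: "'i \<Rightarrow> 'a measure" and h :: "'i \<Rightarrow> 'a \<Rightarrow> ennreal"
  assumes I: "finite I"
    and M: "\<And>i. sigma_finite_measure (M i)"
    and D: "\<And>i. sigma_finite_measure (density (M i) (h i))"
    and h [measurable]: "\<And>i. h i \<in> borel_measurable (M i)"
  shows "PiM I (\<lambda>i. density (M i) (h i)) = density (PiM I M) (\<lambda>x. \<Prod>i\<in>I. h i (x i))"
proof -
  interpret M: product_sigma_finite M by (rule product_sigma_finite.intro) (rule M)
  interpret D: product_sigma_finite "\<lambda>i. density (M i) (h i)" by (rule product_sigma_finite.intro) (rule D)
  show ?thesis
  proof (rule D.PiM_eqI[symmetric])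
    show "finite I" by fact
    show "sets (density (PiM I M) (\<lambda>x. \<Prod>i\<in>I. h i (x i))) = sets (PiM I (\<lambda>i. density (M i) (h i)))"
      by (auto intro!: sets_PiM_cong)
    fix A assume A: "\<And>i. i \<in> I \<Longrightarrow> A i \<in> sets (density (M i) (h i))"
    then have A' [measurable]: "\<And>i. i \<in> I \<Longrightarrow> A i \<in> sets (M i)" by simp
    \<comment> \<open>As a product of one-coordinate indicators, the indicator of a box merges with
      the product of densities, and the integral factors.\<close>
    have ind: "indicator (Pi\<^sub>E I A) x = (\<Prod>i\<in>I. indicator (A i) (x i) :: ennreal)" if "x \<in> space (PiM I M)" for x
    proof (cases "\<forall>i\<in>I. x i \<in> A i")
      case True then show ?thesis using that by (auto simp: space_PiM PiE_iff)
    next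
      case False
      then have "(\<Prod>i\<in>I. indicator (A i) (x i) :: ennreal) = 0" using I by (intro prod_zero) (auto simp: indicator_def)
      moreover have "x \<notin> Pi\<^sub>E I A" using False by auto
      ultimately show ?thesis by simp
    qed
    have "emeasure (density (PiM I M) (\<lambda>x. \<Prod>i\<in>I. h i (x i))) (Pi\<^sub>E I A)
      = (\<integral>\<^sup>+ x. (\<Prod>i\<in>I. h i (x i)) * indicator (Pi\<^sub>E I A) x \<partial>PiM I M)"
      using I by (intro emeasure_density sets_PiM_I_finite) auto
    also have "\<dots> = (\<integral>\<^sup>+ x. (\<Prod>i\<in>I. h i (x i) * indicator (A i) (x i)) \<partial>PiM I M)"
      by (intro nn_integral_cong) (simp add: ind prod.distrib)
    also have "\<dots> = (\<Prod>i\<in>I. \<integral>\<^sup>+ x. h i x * indicator (A i) x \<partial>M i)"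
      using I by (intro M.product_nn_integral_prod) auto
    also have "\<dots> = (\<Prod>i\<in>I. emeasure (density (M i) (h i)) (A i))"
      by (intro prod.cong refl emeasure_density[symmetric]) auto
    finally show "emeasure (density (PiM I M) (\<lambda>x. \<Prod>i\<in>I. h i (x i))) (Pi\<^sub>E I A)
       = (\<Prod>i\<in>I. emeasure (density (M i) (h i)) (A i))" .
  qed
qed

text \<open>Independence amounts to the joint law being the product of the marginals; the joint map
  is the identity on the product space.\<close>

lemma (in product_prob_space) indep_vars_component:
  assumes "I \<noteq> {}"
  shows "P.indep_vars M (\<lambda>i \<omega>. \<omega> i) I"
proof (subst P.indep_vars_iff_distr_eq_PiM'[OF assms])
  show "distr (PiM I M) (PiM I M) (\<lambda>x. \<lambda>i\<in>I. x i) = PiM I (\<lambda>i. distr (PiM I M) (M i) (\<lambda>\<omega>. \<omega> i))"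
  proof -
    have "distr (PiM I M) (PiM I M) (\<lambda>x. \<lambda>i\<in>I. x i) = distr (PiM I M) (PiM I M) (\<lambda>x. x)"
      by (intro distr_cong) (auto simp: space_PiM PiE_iff extensional_def fun_eq_iff restrict_def)
    also have "\<dots> = PiM I (\<lambda>i. distr (PiM I M) (M i) (\<lambda>\<omega>. \<omega> i))"
      by (subst distr_id) (intro PiM_cong refl PiM_component[symmetric], auto)
    finally show ?thesis .
  qed
qed auto

locale multistream =
  fixes L :: nat and rho :: "nat \<Rightarrow> real"
    and N :: "'a measure" and f0 f1 :: "'a \<Rightarrow> real"
  assumes L: "L \<ge> 1"
    and rho: "\<And>l. l \<in> {1..L} \<Longrightarrow> 0 < rho l \<and> rho l < 1"
    and f0_meas [measurable]: "f0 \<in> borel_measurable N"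
    and f1_meas [measurable]: "f1 \<in> borel_measurable N"
    and f0_nonneg: "\<And>x. x \<in> space N \<Longrightarrow> 0 \<le> f0 x"
    and f1_nonneg: "\<And>x. x \<in> space N \<Longrightarrow> 0 \<le> f1 x"
    and f0_dens: "(\<integral>\<^sup>+ x. ennreal (f0 x) \<partial>N) = 1"
    and f1_dens: "(\<integral>\<^sup>+ x. ennreal (f1 x) \<partial>N) = 1"
    and mutual_ac: "AE x in N. (0 < f0 x \<longleftrightarrow> 0 < f1 x)"
    and D_finite: "integrable N (\<lambda>x. f1 x * ln (f1 x / f0 x))"
begin

abbreviation "M \<equiv> model L rho N f0 f1"
abbreviation "F \<equiv> obs_filt L rho N f0 f1"
abbreviation "P \<equiv> obs_meas N f0 f1"
abbreviation "cp \<equiv> cp_pmf L rho"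
abbreviation "P0 \<equiv> density N f0"
abbreviation "P1 \<equiv> density N f1"
abbreviation "D \<equiv> KL N f1 f0"
text \<open>The model carries a value at every pair of naturals; only these cells, with times and
  streams counted from 1, enter the filtration.\<close>

definition J :: "nat \<Rightarrow> (nat \<times> nat) set" where "J k = {1..k} \<times> {1..L}"

abbreviation "obs k \<omega> \<equiv> restrict (snd \<omega>) (J k)"

definition lr :: "'a \<Rightarrow> real" where "lr x = f1 x / f0 x"

definition law :: "(nat \<Rightarrow> nat) \<Rightarrow> nat \<times> nat \<Rightarrow> 'a measure" where
  "law g i = (if fst i < g (snd i) then P0 else P1)"

text \<open>Likelihood ratio of the change-points \<open>g\<close> against "no change ever", on the
  data up to time \<open>k\<close>. It is \<open>ennreal\<close>-valued to serve in
  \<open>density\<close>; \<open>likr\<close> is its real counterpart for arithmetic.\<close>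

definition Lik :: "(nat \<Rightarrow> nat) \<Rightarrow> nat \<Rightarrow> (nat \<times> nat \<Rightarrow> 'a) \<Rightarrow> ennreal" where
  "Lik g k z = (\<Prod>i\<in>J k. if fst i < g (snd i) then 1 else ennreal (lr (z i)))"

text \<open>The reference law is built from \<open>P0\<close>, not from \<open>N\<close>, because \<open>N\<close> need not be sigma-finite.\<close>

definition Pinf :: "nat \<Rightarrow> (nat \<times> nat \<Rightarrow> 'a) measure" where
  "Pinf k = PiM (J k) (\<lambda>_. P0)"

lemma finite_J [simp]: "finite (J k)"
  by (simp add: J_def)

lemma lr_measurable [measurable]: "lr \<in> borel_measurable N"
  unfolding lr_def by measurable

lemma prob_P0: "prob_space P0"
  by (intro prob_spaceI) (simp add: emeasure_density f0_dens cong: nn_integral_cong)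

lemma prob_P1: "prob_space P1"
  by (intro prob_spaceI) (simp add: emeasure_density f1_dens cong: nn_integral_cong)

lemma obs_meas_eq: "P g = PiM UNIV (law g)"
  unfolding obs_meas_def law_def by (intro arg_cong2[where f=PiM] refl ext) auto

lemma prob_law: "prob_space (law g i)"
  by (simp add: law_def prob_P0 prob_P1)

lemma sets_law [measurable_cong, simp]: "sets (law g i) = sets N"
  by (simp add: law_def)

lemma space_law [simp]: "space (law g i) = space N"
  by (simp add: law_def)

lemma product_prob_law: "product_prob_space (law g)"
  by (intro product_prob_spaceI prob_law)

lemma sets_P [measurable_cong, simp]: "sets (P g) = sets (PiM UNIV (\<lambda>_. N))"
  unfolding obs_meas_eq by (intro sets_PiM_cong) auto

lemma space_P [simp]: "space (P g) = space (PiM UNIV (\<lambda>_. N))"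
  by (intro sets_eq_imp_space_eq sets_P)

lemma prob_P: "prob_space (P g)"
  unfolding obs_meas_eq by (intro prob_space_PiM prob_law)

text \<open>Mutual absolute continuity enters here: where \<open>f0 x = 0\<close>, almost everywhere
  also \<open>f1 x = 0\<close>, so the convention that division by 0 gives 0 loses no mass.\<close>

lemma P1_density: "P1 = density P0 (\<lambda>x. ennreal (lr x))"
proof -
  have "density P0 (\<lambda>x. ennreal (lr x)) = density N (\<lambda>x. ennreal (f0 x) * ennreal (lr x))"
    by (intro density_density_eq) auto
  also have "\<dots> = density N (\<lambda>x. ennreal (f1 x))"
  proof (rule density_cong)
    show "AE x in N. ennreal (f0 x) * ennreal (lr x) = ennreal (f1 x)"
      using mutual_ac AE_space
    proof eventually_elim
      case (elim x)
      then show ?case using f0_nonneg[of x] f1_nonneg[of x]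
        by (cases "f0 x = 0") (auto simp: lr_def ennreal_mult[symmetric])
    qed
  qed auto
  finally show ?thesis ..
qed

lemma sets_Pinf [measurable_cong, simp]: "sets (Pinf k) = sets (PiM (J k) (\<lambda>_. N))"
  unfolding Pinf_def by (intro sets_PiM_cong) auto

lemma space_Pinf [simp]: "space (Pinf k) = space (PiM (J k) (\<lambda>_. N))"
  by (intro sets_eq_imp_space_eq sets_Pinf)

lemma Lik_measurable [measurable]: "Lik g k \<in> borel_measurable (PiM (J k) (\<lambda>_. N))"
  unfolding Lik_def by measurable

lemma restrict_J_measurable [measurable]:
  "(\<lambda>z. restrict z (J k)) \<in> measurable (PiM UNIV (\<lambda>_. N)) (PiM (J k) (\<lambda>_. N))"
  by (intro measurable_restrict_subset) auto

text \<open>Restricting to the finitely many cells of \<open>J k\<close> makes a density available;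
  the infinite product laws themselves may be mutually singular.\<close>

lemma marginal: "distr (P g) (PiM (J k) (\<lambda>_. N)) (\<lambda>z. restrict z (J k)) = density (Pinf k) (Lik g k)"
proof -
  interpret product_prob_space "law g" UNIV by (rule product_prob_law)
  have "distr (P g) (PiM (J k) (\<lambda>_. N)) (\<lambda>z. restrict z (J k))
      = distr (P g) (PiM (J k) (law g)) (\<lambda>z. restrict z (J k))"
    by (intro distr_cong refl sets_PiM_cong) auto
  also have "\<dots> = PiM (J k) (law g)"
    unfolding obs_meas_eq by (intro distr_PiM_restrict_finite) auto
  also have "\<dots> = PiM (J k) (\<lambda>i. density P0 (if fst i < g (snd i) then (\<lambda>_. 1) else (\<lambda>x. ennreal (lr x))))"
    by (intro PiM_cong refl) (simp add: law_def P1_density[symmetric] density_1)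
  also have "\<dots> = density (PiM (J k) (\<lambda>_. P0)) (\<lambda>z. \<Prod>i\<in>J k. (if fst i < g (snd i) then (\<lambda>_. 1) else (\<lambda>x. ennreal (lr x))) (z i))"
    by (intro density_PiM)
       (auto simp: P1_density[symmetric] density_1 prob_P0 prob_P1 prob_space_imp_sigma_finite)
  also have "\<dots> = density (Pinf k) (Lik g k)"
    unfolding Pinf_def Lik_def by (intro density_cong refl AE_I2 arg_cong2[where f=density] ext prod.cong) auto
  finally show ?thesis .
qed

lemma nn_integral_P_obs:
  assumes [measurable]: "h \<in> borel_measurable (PiM (J k) (\<lambda>_. N))"
  shows "(\<integral>\<^sup>+ z. h (restrict z (J k)) \<partial>P g) = (\<integral>\<^sup>+ y. Lik g k y * h y \<partial>Pinf k)"
proof -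
  have "(\<integral>\<^sup>+ z. h (restrict z (J k)) \<partial>P g) = (\<integral>\<^sup>+ y. h y \<partial>distr (P g) (PiM (J k) (\<lambda>_. N)) (\<lambda>z. restrict z (J k)))"
    by (subst nn_integral_distr) auto
  then show ?thesis by (simp add: marginal nn_integral_density)
qed

lemma kernel_measurable [measurable]:
  "(\<lambda>g. distr (P g) (count_space UNIV \<Otimes>\<^sub>M PiM UNIV (\<lambda>_. N)) (\<lambda>z. (g, z)))
    \<in> measurable (measure_pmf cp) (subprob_algebra (count_space UNIV \<Otimes>\<^sub>M PiM UNIV (\<lambda>_. N)))"
  by (auto simp: measurable_pmf_measure1 space_subprob_algebra intro!: prob_space_imp_subprob_space
      prob_space.prob_space_distr prob_P)

lemma sets_M [measurable_cong, simp]: "sets M = sets (count_space UNIV \<Otimes>\<^sub>M PiM UNIV (\<lambda>_. N))"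
  unfolding model_def by (intro sets_bind) auto

lemma space_M [simp]: "space M = UNIV \<times> space (PiM UNIV (\<lambda>_. N))"
  by (subst sets_eq_imp_space_eq[OF sets_M]) (simp add: space_pair_measure)

lemma prob_M: "prob_space M"
  unfolding model_def
  by (intro measure_pmf.prob_space_bind[OF _ kernel_measurable] AE_I2 prob_space.prob_space_distr prob_P) auto

lemma nn_integral_M:
  assumes [measurable]: "h \<in> borel_measurable (count_space UNIV \<Otimes>\<^sub>M PiM UNIV (\<lambda>_. N))"
  shows "(\<integral>\<^sup>+ \<omega>. h \<omega> \<partial>M) = (\<integral>\<^sup>+ g. (\<integral>\<^sup>+ z. h (g, z) \<partial>P g) \<partial>cp)"
  unfolding model_def by (subst nn_integral_bind[OF assms kernel_measurable]) (simp add: nn_integral_distr)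

lemma AE_M:
  assumes [measurable]: "Measurable.pred (count_space UNIV \<Otimes>\<^sub>M PiM UNIV (\<lambda>_. N)) Q"
  shows "(AE \<omega> in M. Q \<omega>) \<longleftrightarrow> (\<forall>g\<in>set_pmf cp. AE z in P g. Q (g, z))"
  unfolding model_def by (subst AE_bind[OF kernel_measurable assms]) (simp add: AE_distr_iff AE_measure_pmf_iff)

text \<open>Prior weight times likelihood against the common reference law: the form in which Bayes'
  rule is applied to the posteriors.\<close>

lemma nn_integral_M_obs:
  assumes [measurable]: "h \<in> borel_measurable (PiM (J k) (\<lambda>_. N))"
  shows "(\<integral>\<^sup>+ \<omega>. q (fst \<omega>) * h (obs k \<omega>) \<partial>M) = (\<integral>\<^sup>+ g. q g * (\<integral>\<^sup>+ y. Lik g k y * h y \<partial>Pinf k) \<partial>cp)"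
proof (subst nn_integral_M)
  have [measurable]: "(\<lambda>\<omega>. q (fst \<omega>)) \<in> borel_measurable (count_space UNIV \<Otimes>\<^sub>M PiM UNIV (\<lambda>_. N))"
    by (rule measurable_compose[OF measurable_fst]) simp
  show "(\<lambda>\<omega>. q (fst \<omega>) * h (obs k \<omega>)) \<in> borel_measurable (count_space UNIV \<Otimes>\<^sub>M PiM UNIV (\<lambda>_. N))"
    by measurable
  show "(\<integral>\<^sup>+ g. (\<integral>\<^sup>+ z. q (fst (g, z)) * h (obs k (g, z)) \<partial>P g) \<partial>cp) = (\<integral>\<^sup>+ g. q g * (\<integral>\<^sup>+ y. Lik g k y * h y \<partial>Pinf k) \<partial>cp)"
    by (intro nn_integral_cong) (simp add: nn_integral_cmult nn_integral_P_obs)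
qed

end

section \<open>Law of the change-points\<close>

lemma measure_geometric_pmf_atLeast:
  assumes "0 < p" "p \<le> 1"
  shows "measure (geometric_pmf p) {m..} = (1 - p) ^ m"
proof -
  have "measure (geometric_pmf p) {..<m} = (\<Sum>i<m. (1 - p) ^ i * p)"
    using assms by (simp add: measure_measure_pmf_finite)
  also have "\<dots> = 1 - (1 - p) ^ m"
    using one_diff_power_eq[of "1 - p" m] by (simp add: sum_distrib_left mult.commute)
  finally have "measure (geometric_pmf p) {..<m} = 1 - (1 - p) ^ m" .
  moreover have "measure (geometric_pmf p) {m..} = 1 - measure (geometric_pmf p) {..<m}"
    by (subst measure_pmf.prob_compl[symmetric]) (auto intro!: arg_cong2[where f=measure])
  ultimately show ?thesis by simp
qed

lemma cp_pmf_mono: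
  assumes "g \<in> set_pmf (cp_pmf n rho)" "1 \<le> i" "i \<le> j" "j \<le> n"
  shows "g i \<le> g j"
  using assms
proof (induction n arbitrary: g i j)
  case (Suc n)
  from Suc.prems(1) obtain h d where h: "h \<in> set_pmf (cp_pmf n rho)"
    and g: "g = h(Suc n := (if n = 0 then 0 else h n) + d)"
    by (auto simp: set_bind_pmf)
  show ?case
  proof (cases "j = Suc n")
    case True
    show ?thesis
    proof (cases "i = Suc n")
      case False
      then have "h i \<le> h n" "n \<noteq> 0" using Suc.IH[OF h] Suc.prems True by auto
      then show ?thesis using False True by (simp add: g)
    qed (simp add: True)
  next
    case False
    then show ?thesis using Suc.IH[OF h] Suc.prems by (auto simp: g)
  qed
qed simp

lemma map_pmf_cp_pmf_1: "1 \<le> n \<Longrightarrow> map_pmf (\<lambda>g. g 1) (cp_pmf n rho) = geometric_pmf (rho 1)"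
proof (induction n rule: nat_induct_at_least)
  case base
  show ?case by (simp add: bind_return_pmf pmf.map_comp o_def)
next
  case (Suc n)
  then show ?case by (simp add: map_bind_pmf pmf.map_comp o_def map_pmf_def[symmetric])
qed

text \<open>One way to reach the constant configuration is \<Gamma>_1 = \<open>m\<close> followed by
  zero increments, which have probabilities \<open>rho l\<close>. A lower bound suffices, so no
  other way has to be excluded.\<close>

lemma pmf_cp_pmf_const_ge:
  assumes "1 \<le> n" "\<And>l. l \<in> {1..n} \<Longrightarrow> 0 < rho l \<and> rho l < 1"
  shows "(1 - rho 1) ^ m * (\<Prod>l=1..n. rho l) \<le> pmf (cp_pmf n rho) (\<lambda>l. if l \<in> {1..n} then m else 0)"
  using assms
proof (induction n rule: nat_induct_at_least)
  case base
  have "(1 - rho 1) ^ m * rho 1 = pmf (geometric_pmf (rho 1)) m" using base by simp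
  also have "\<dots> \<le> pmf (map_pmf (\<lambda>d. (\<lambda>_. 0)(Suc 0 := d)) (geometric_pmf (rho 1))) ((\<lambda>_. 0)(Suc 0 := m))"
    by (subst pmf_map_inj') (auto simp: inj_def fun_upd_def fun_eq_iff)
  also have "((\<lambda>_. 0)(Suc 0 := m)) = (\<lambda>l. if l \<in> {1..1} then m else 0)"
    by (auto simp: fun_eq_iff)
  finally show ?case by (simp add: bind_return_pmf fun_upd_def[abs_def])
next
  case (Suc n)
  let ?h = "\<lambda>l. if l \<in> {1..n} then m else 0" and ?h' = "\<lambda>l. if l \<in> {1..Suc n} then m else 0"
  let ?K = "\<lambda>g. map_pmf (\<lambda>d. g(Suc n := (if n = 0 then 0 else g n) + d)) (geometric_pmf (rho (Suc n)))"
  have r: "0 < rho (Suc n)" "rho (Suc n) < 1" using Suc.prems by auto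
  have "rho (Suc n) = pmf (geometric_pmf (rho (Suc n))) 0" using r by simp
  also have "\<dots> \<le> measure (?K ?h) {?h'}"
  proof -
    have "?h' = ?h(Suc n := (if n = 0 then 0 else ?h n) + 0)" using Suc.hyps by (auto simp: fun_eq_iff)
    then show ?thesis
      by (auto simp: measure_pmf_single[symmetric] simp del: measure_pmf_single pmf_geometric intro!: measure_pmf.finite_measure_mono)
  qed
  finally have 1: "rho (Suc n) \<le> pmf (?K ?h) ?h'" by (simp add: measure_pmf_single)
  \<comment> \<open>Only the value \<open>?h\<close> of the outer draw is kept in the
    mixture.\<close>
  have "ennreal (pmf (?K ?h) ?h' * pmf (cp_pmf n rho) ?h) = (\<integral>\<^sup>+ g. ennreal (pmf (?K ?h) ?h') * indicator {?h} g \<partial>cp_pmf n rho)"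
    by (subst nn_integral_cmult_indicator) (auto simp: emeasure_pmf_single ennreal_mult)
  also have "\<dots> \<le> (\<integral>\<^sup>+ g. ennreal (pmf (?K g) ?h') \<partial>cp_pmf n rho)"
    by (intro nn_integral_mono) (auto simp: indicator_def)
  also have "\<dots> = ennreal (pmf (cp_pmf (Suc n) rho) ?h')"
    by (simp add: ennreal_pmf_bind)
  finally have 2: "pmf (?K ?h) ?h' * pmf (cp_pmf n rho) ?h \<le> pmf (cp_pmf (Suc n) rho) ?h'"
    by simp
  have IH: "(1 - rho 1) ^ m * (\<Prod>l=1..n. rho l) \<le> pmf (cp_pmf n rho) ?h"
    using Suc.IH Suc.prems by auto
  have 0: "0 \<le> (1 - rho 1) ^ m * (\<Prod>l=1..n. rho l)"
    using Suc.prems[of 1] Suc.prems by (intro mult_nonneg_nonneg prod_nonneg ballI) (auto intro: less_imp_le)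
  have "(1 - rho 1) ^ m * (\<Prod>l=1..Suc n. rho l) = rho (Suc n) * ((1 - rho 1) ^ m * (\<Prod>l=1..n. rho l))"
    by simp
  also have "\<dots> \<le> pmf (?K ?h) ?h' * pmf (cp_pmf n rho) ?h"
    using 0 1 IH r by (intro mult_mono) linarith+
  finally show ?case using 2 by (rule order.trans)
qed

text \<open>The random walk of the upper bound starts only at \<Gamma>_L, so the mean of \<Gamma>_L
  enters the additive constant and must be finite.\<close>

lemma nn_integral_cp_pmf_finite:
  assumes "\<And>l. l \<in> {1..n} \<Longrightarrow> 0 < rho l \<and> rho l < 1"
  shows "(\<integral>\<^sup>+ g. of_nat (g n) \<partial>cp_pmf n rho) < \<infinity>"
  using assms
proof (induction n)
  case (Suc n)
  have geo: "(\<integral>\<^sup>+ d. of_nat d \<partial>geometric_pmf (rho (Suc n))) < (\<infinity>::ennreal)"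
  proof -
    have "integrable (geometric_pmf (rho (Suc n))) real"
      using Suc.prems[of "Suc n"] by (intro integrable_real_geometric_pmf) auto
    then show ?thesis by (simp add: integrable_iff_bounded ennreal_of_nat_eq_real_of_nat)
  qed
  have "(\<integral>\<^sup>+ g. of_nat (g (Suc n)) \<partial>cp_pmf (Suc n) rho)
     = (\<integral>\<^sup>+ g. (\<integral>\<^sup>+ d. of_nat ((if n = 0 then 0 else g n) + d) \<partial>geometric_pmf (rho (Suc n))) \<partial>cp_pmf n rho)"
    by (simp add: nn_integral_bind_pmf nn_integral_map_pmf)
  also have "\<dots> \<le> (\<integral>\<^sup>+ g. of_nat (g n) + (\<integral>\<^sup>+ d. of_nat d \<partial>geometric_pmf (rho (Suc n))) \<partial>cp_pmf n rho)"
    by (intro nn_integral_mono) (auto simp: nn_integral_add measure_pmf.emeasure_space_1)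
  also have "\<dots> = (\<integral>\<^sup>+ g. of_nat (g n) \<partial>cp_pmf n rho) + (\<integral>\<^sup>+ d. of_nat d \<partial>geometric_pmf (rho (Suc n)))"
    by (simp add: nn_integral_add measure_pmf.emeasure_space_1)
  also have "\<dots> < \<infinity>" using Suc geo by simp
  finally show ?case .
qed simp

section \<open>Posterior probabilities\<close>

text \<open>The set where the conditional expectation is negative belongs to \<open>F\<close>, so
  the hypothesis applies to it and forces it to be null. This turns comparisons of integrals over
  observable events into pointwise inequalities of posteriors.\<close>

lemma (in sigma_finite_subalgebra) real_cond_exp_nonneg_AE:
  assumes w: "integrable M w" and nn: "\<And>A. A \<in> sets F \<Longrightarrow> 0 \<le> (\<integral>x\<in>A. w x \<partial>M)"
  shows "AE x in M. 0 \<le> real_cond_exp M F w x"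
proof -
  let ?r = "real_cond_exp M F w"
  define A where "A = {x \<in> space M. ?r x < 0}"
  have AF: "A \<in> sets F"
  proof -
    have "{x \<in> space F. ?r x < 0} \<in> sets F" using borel_measurable_cond_exp[of M F w] by measurable
    moreover have "space F = space M" using subalg by (simp add: subalgebra_def)
    ultimately show ?thesis by (simp add: A_def)
  qed
  then have AM [measurable]: "A \<in> sets M" using subalg by (auto simp: subalgebra_def)
  have "0 \<le> (\<integral>x\<in>A. ?r x \<partial>M)" using nn[OF AF] real_cond_exp_intA[OF w AF] by simp
  moreover have "(\<integral>x. indicator A x * - ?r x \<partial>M) = - (\<integral>x\<in>A. ?r x \<partial>M)"
    by (simp add: set_lebesgue_integral_def)
  moreover have int: "integrable M (\<lambda>x. indicator A x * - ?r x)"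
    using integrable_mult_indicator[OF AM integrable_minus[OF real_cond_exp_int(1)[OF w]]] by simp
  moreover have pos: "AE x in M. 0 \<le> indicator A x * - ?r x"
    by (auto simp: A_def indicator_def)
  ultimately have "(\<integral>x. indicator A x * - ?r x \<partial>M) = 0"
    using integral_nonneg_AE[OF pos] by linarith
  then have "AE x in M. indicator A x * - ?r x = 0"
    using integral_nonneg_eq_0_iff_AE[OF int pos] by simp
  then show ?thesis
    using AE_space by eventually_elim (auto simp: A_def indicator_def not_less split: if_splits)
qed

context multistream begin

lemma rho1: "0 < rho 1" "rho 1 < 1"
  using rho[of 1] L by auto

lemma lr_nonneg: "x \<in> space N \<Longrightarrow> 0 \<le> lr x"
  unfolding lr_def using f0_nonneg f1_nonneg by simp

lemma measure_cp_Gamma1: "measure cp {g. m \<le> g 1} = (1 - rho 1) ^ m"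
proof -
  have "measure cp {g. m \<le> g 1} = measure (map_pmf (\<lambda>g. g 1) cp) {m..}"
    unfolding measure_map_pmf by (intro arg_cong2[where f=measure]) auto
  also have "\<dots> = (1 - rho 1) ^ m"
    unfolding map_pmf_cp_pmf_1[OF L] using rho1 by (intro measure_geometric_pmf_atLeast) auto
  finally show ?thesis .
qed

lemma measure_cp_all_ge: "measure cp {g. \<forall>l\<in>{1..L}. m \<le> g l} = (1 - rho 1) ^ m"
proof -
  have "measure cp {g. \<forall>l\<in>{1..L}. m \<le> g l} = measure cp {g. m \<le> g 1}"
  proof (rule measure_pmf.finite_measure_eq_AE)
    show "AE g in cp. (g \<in> {g. \<forall>l\<in>{1..L}. m \<le> g l}) = (g \<in> {g. m \<le> g 1})"
      using cp_pmf_mono[of _ L rho 1] L by (auto simp: AE_measure_pmf_iff intro: order.trans)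
  qed auto
  then show ?thesis unfolding measure_cp_Gamma1 .
qed

lemma fst_M_measurable [measurable]: "fst \<in> measurable M (count_space UNIV)"
  by (simp cong: measurable_cong_sets)

lemma obs_M_measurable [measurable]: "(\<lambda>\<omega>. obs k \<omega>) \<in> measurable M (PiM (J k) (\<lambda>_. N))"
  by measurable

lemma space_F [simp]: "space (F k) = space M"
  by (simp add: obs_filt_def)

lemma obs_F_measurable [measurable]: "(\<lambda>\<omega>. obs k \<omega>) \<in> measurable (F k) (PiM (J k) (\<lambda>_. N))"
  unfolding obs_filt_def J_def
  by (rule measurable_vimage_algebra1) (use measurable_space[OF obs_M_measurable[of k]] in \<open>auto simp: J_def\<close>)

text \<open>An event known at time \<open>k\<close> is represented by a set \<open>B\<close> of
  data, which can then be measured under \<open>Pinf k\<close> as well.\<close>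

lemma sets_F_iff: "A \<in> sets (F k) \<longleftrightarrow> (\<exists>B\<in>sets (PiM (J k) (\<lambda>_. N)). A = {\<omega>\<in>space M. obs k \<omega> \<in> B})"
proof -
  have "(\<lambda>\<omega>. obs k \<omega>) \<in> space M \<rightarrow> space (PiM (J k) (\<lambda>_. N))"
    using measurable_space[OF obs_M_measurable[of k]] by auto
  from sets_vimage_algebra2[OF this]
  have "sets (F k) = {(\<lambda>\<omega>. obs k \<omega>) -` B \<inter> space M | B. B \<in> sets (PiM (J k) (\<lambda>_. N))}"
    unfolding obs_filt_def J_def .
  then show ?thesis by (auto simp: vimage_def)
qed

lemma subalgebra_F: "subalgebra M (F k)"
proof -
  have "A \<in> sets M" if "A \<in> sets (F k)" for A
  proof -
    from that obtain B where [measurable]: "B \<in> sets (PiM (J k) (\<lambda>_. N))" and A: "A = {\<omega>\<in>space M. obs k \<omega> \<in> B}"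
      by (auto simp: sets_F_iff)
    show ?thesis unfolding A by measurable
  qed
  then show ?thesis by (auto simp: subalgebra_def)
qed

lemma F_mono: "j \<le> k \<Longrightarrow> sets (F j) \<subseteq> sets (F k)"
proof
  fix A assume jk: "j \<le> k" and "A \<in> sets (F j)"
  then obtain B where [measurable]: "B \<in> sets (PiM (J j) (\<lambda>_. N))" and A: "A = {\<omega>\<in>space M. obs j \<omega> \<in> B}"
    by (auto simp: sets_F_iff)
  have sub: "J j \<subseteq> J k" using jk by (auto simp: J_def)
  then have "(\<lambda>y. restrict y (J j)) \<in> measurable (PiM (J k) (\<lambda>_. N)) (PiM (J j) (\<lambda>_. N))"
    by (intro measurable_restrict_subset)
  from measurable_compose[OF obs_F_measurable this]
  have [measurable]: "(\<lambda>\<omega>. obs j \<omega>) \<in> measurable (F k) (PiM (J j) (\<lambda>_. N))"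
    using sub by (simp add: Int_absorb1)
  have "{\<omega>\<in>space (F k). obs j \<omega> \<in> B} \<in> sets (F k)" by measurable
  then show "A \<in> sets (F k)" by (simp add: A)
qed

lemma sigma_finite_F: "sigma_finite_subalgebra M (F k)"
proof -
  interpret prob_space M by (rule prob_M)
  interpret finite_measure_subalgebra M "F k" by unfold_locales (rule subalgebra_F)
  show ?thesis by unfold_locales
qed

lemma borel_measurable_cp_event [measurable]: "(indicator (cp_event L k l) :: _ \<Rightarrow> real) \<in> borel_measurable M"
proof -
  define Q where "Q = {g. (\<forall>i\<in>{1..<l}. g i \<le> k) \<and> (\<forall>i\<in>{l..L}. k < g i)}"
  have "(\<lambda>\<omega>. indicator Q (fst \<omega>) :: real) \<in> borel_measurable M"
    by (rule measurable_compose[OF fst_M_measurable]) simp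
  moreover have "(\<lambda>\<omega>. indicator Q (fst \<omega>)) = (indicator (cp_event L k l) :: (nat \<Rightarrow> nat) \<times> (nat \<times> nat \<Rightarrow> 'a) \<Rightarrow> real)"
    by (auto simp: Q_def cp_event_def fun_eq_iff indicator_def)
  ultimately show ?thesis by simp
qed

lemma integrable_cp_event: "integrable M (indicator (cp_event L k l) :: _ \<Rightarrow> real)"
proof -
  interpret prob_space M by (rule prob_M)
  show ?thesis by (intro integrable_const_bound[where B=1]) (auto simp: indicator_def)
qed

lemma AE_fst_M: "AE \<omega> in M. fst \<omega> \<in> set_pmf cp"
proof (subst AE_M)
  show "Measurable.pred (count_space UNIV \<Otimes>\<^sub>M PiM UNIV (\<lambda>_. N)) (\<lambda>\<omega>. fst \<omega> \<in> set_pmf cp)"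
    by (rule measurable_compose[OF measurable_fst]) simp
qed auto

lemma post_F_measurable [measurable]: "post L rho N f0 f1 k l \<in> borel_measurable (F k)"
  unfolding post_def by simp

lemma post_M_measurable [measurable]: "post L rho N f0 f1 k l \<in> borel_measurable M"
  using measurable_from_subalg[OF subalgebra_F post_F_measurable] .

text \<open>The change-points are almost surely ordered, so the streams that have changed by time
  \<open>k\<close> form an initial segment and exactly one of the \<open>L + 1\<close> events
  occurs; conditional expectation is linear.\<close>

lemma post_sum: "AE \<omega> in M. (\<Sum>l=2..L+1. post L rho N f0 f1 k l \<omega>) = 1 - post L rho N f0 f1 k 1 \<omega>"
proof -
  interpret prob_space M by (rule prob_M)
  interpret sigma_finite_subalgebra M "F k" by (rule sigma_finite_F)
  have "AE \<omega> in M. (\<Sum>l=1..L+1. indicator (cp_event L k l) \<omega> :: real) = 1"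
    using AE_fst_M
  proof eventually_elim
    case (elim \<omega>)
    define S where "S = {l\<in>{1..L}. k < fst \<omega> l}"
    \<comment> \<open>The first stream still unchanged at time \<open>k\<close>, or
      \<open>L + 1\<close> if all have changed.\<close>
    define l0 where "l0 = (if S = {} then L + 1 else Min S)"
    have fin: "finite S" by (simp add: S_def)
    have S: "l \<in> S \<longleftrightarrow> l0 \<le> l" if "l \<in> {1..L}" for l
    proof (cases "S = {}")
      case True then show ?thesis using that by (auto simp: l0_def)
    next
      case False
      then have m: "Min S \<in> S" using fin by simp
      show ?thesis
      proof
        assume "l \<in> S" then show "l0 \<le> l" using fin False by (simp add: l0_def)
      next
        assume "l0 \<le> l"
        moreover have "1 \<le> Min S" using m unfolding S_def by auto
        ultimately have "fst \<omega> (Min S) \<le> fst \<omega> l"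
          using cp_pmf_mono[OF elim, of "Min S" l] that False unfolding l0_def by simp
        then show "l \<in> S" using m that by (auto simp: S_def)
      qed
    qed
    have l0: "l0 \<in> {1..L+1}"
    proof (cases "S = {}")
      case False
      then have "Min S \<in> S" using fin by simp
      then have "Min S \<in> {1..L}" by (simp add: S_def)
      then show ?thesis using False by (simp add: l0_def)
    qed (simp add: l0_def)
    have "\<omega> \<in> cp_event L k l \<longleftrightarrow> l = l0" if l: "l \<in> {1..L+1}" for l
    proof
      assume *: "\<omega> \<in> cp_event L k l"
      show "l = l0"
      proof (rule ccontr)
        assume "l \<noteq> l0"
        then consider "l < l0" | "l0 < l" by linarith
        then show False
        proof cases
          case 1
          then have "l \<in> {1..L}" using l l0 by auto
          then show False using S[of l] * 1 by (auto simp: cp_event_def S_def)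
        next
          case 2
          then have "l0 \<in> {1..L}" using l l0 by auto
          moreover from this have "fst \<omega> l0 \<le> k" using * 2 unfolding cp_event_def by simp
          ultimately show False using S[of l0] by (simp add: S_def)
        qed
      qed
    next
      assume "l = l0"
      then show "\<omega> \<in> cp_event L k l" using S l0
        by (auto simp: cp_event_def S_def not_less[symmetric])
    qed
    then have "(\<Sum>l=1..L+1. indicator (cp_event L k l) \<omega> :: real) = (\<Sum>l=1..L+1. if l = l0 then 1 else 0)"
      by (intro sum.cong refl) (auto simp: indicator_def)
    also have "\<dots> = 1" using l0 by simp
    finally show ?case .
  qed
  then have "AE \<omega> in M. real_cond_exp M (F k) (\<lambda>\<omega>. \<Sum>l=1..L+1. indicator (cp_event L k l) \<omega>) \<omega> = real_cond_exp M (F k) (\<lambda>_. 1) \<omega>"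
    by (intro real_cond_exp_cong) auto
  moreover have "AE \<omega> in M. real_cond_exp M (F k) (\<lambda>_. 1) \<omega> = 1"
    by (intro real_cond_exp_F_meas) auto
  moreover have "AE \<omega> in M. real_cond_exp M (F k) (\<lambda>\<omega>. \<Sum>l=1..L+1. indicator (cp_event L k l) \<omega>) \<omega> = (\<Sum>l=1..L+1. post L rho N f0 f1 k l \<omega>)"
    unfolding post_def by (intro real_cond_exp_sum integrable_cp_event)
  ultimately show ?thesis
  proof eventually_elim
    case (elim \<omega>)
    have "{1..L+1} = insert 1 {2..L+1}" by auto
    then have "(\<Sum>l=1..L+1. post L rho N f0 f1 k l \<omega>) = post L rho N f0 f1 k 1 \<omega> + (\<Sum>l=2..L+1. post L rho N f0 f1 k l \<omega>)"
      by simp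
    then show ?case using elim by simp
  qed
qed

text \<open>With every change after \<open>k\<close> all factors of \<open>Lik\<close> are 1, so the
  data up to \<open>k\<close> follow the reference law whatever the change-points are. The exponent
  is \<open>Suc k\<close> because \<Gamma>_1 > \<open>k\<close> means \<Gamma>_1 \<ge>
  \<open>Suc k\<close>.\<close>

lemma nn_integral_no_change:
  assumes [measurable]: "h \<in> borel_measurable (PiM (J k) (\<lambda>_. N))"
  shows "(\<integral>\<^sup>+ \<omega>. indicator (cp_event L k 1) \<omega> * h (obs k \<omega>) \<partial>M) = ennreal ((1 - rho 1) ^ Suc k) * (\<integral>\<^sup>+ y. h y \<partial>Pinf k)"
proof -
  let ?Q = "{g::nat\<Rightarrow>nat. \<forall>l\<in>{1..L}. Suc k \<le> g l}"
  have "(\<integral>\<^sup>+ \<omega>. indicator (cp_event L k 1) \<omega> * h (obs k \<omega>) \<partial>M) = (\<integral>\<^sup>+ \<omega>. indicator ?Q (fst \<omega>) * h (obs k \<omega>) \<partial>M)"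
    by (intro nn_integral_cong) (auto simp: indicator_def cp_event_def Suc_le_eq)
  also have "\<dots> = (\<integral>\<^sup>+ g. indicator ?Q g * (\<integral>\<^sup>+ y. Lik g k y * h y \<partial>Pinf k) \<partial>cp)"
    by (rule nn_integral_M_obs) fact
  also have "\<dots> = (\<integral>\<^sup>+ g. (\<integral>\<^sup>+ y. h y \<partial>Pinf k) * indicator ?Q g \<partial>cp)"
  proof (intro nn_integral_cong)
    fix g
    have "Lik g k y = 1" if "g \<in> ?Q" for y
      unfolding Lik_def using that by (intro prod.neutral) (auto simp: J_def Suc_le_eq intro: le_less_trans)
    then show "indicator ?Q g * (\<integral>\<^sup>+ y. Lik g k y * h y \<partial>Pinf k) = (\<integral>\<^sup>+ y. h y \<partial>Pinf k) * indicator ?Q g"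
      by (auto simp: indicator_def)
  qed
  also have "\<dots> = (\<integral>\<^sup>+ y. h y \<partial>Pinf k) * emeasure cp ?Q"
    by (subst nn_integral_cmult_indicator) auto
  also have "emeasure cp ?Q = ennreal ((1 - rho 1) ^ Suc k)"
    using measure_cp_all_ge[of "Suc k"] by (simp add: measure_pmf.emeasure_eq_measure)
  finally show ?thesis unfolding mult.commute[of "ennreal _"] .
qed

lemma emeasure_M_obs:
  assumes [measurable]: "B \<in> sets (PiM (J k) (\<lambda>_. N))"
  shows "emeasure M {\<omega>\<in>space M. obs k \<omega> \<in> B} = (\<integral>\<^sup>+ g. (\<integral>\<^sup>+ y. Lik g k y * indicator B y \<partial>Pinf k) \<partial>cp)"
proof -
  have "emeasure M {\<omega>\<in>space M. obs k \<omega> \<in> B} = (\<integral>\<^sup>+ \<omega>. indicator {\<omega>\<in>space M. obs k \<omega> \<in> B} \<omega> \<partial>M)"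
    by (subst nn_integral_indicator) auto
  also have "\<dots> = (\<integral>\<^sup>+ \<omega>. 1 * indicator B (obs k \<omega>) \<partial>M)"
    by (intro nn_integral_cong) (auto simp: indicator_def)
  also have "\<dots> = (\<integral>\<^sup>+ g. 1 * (\<integral>\<^sup>+ y. Lik g k y * indicator B y \<partial>Pinf k) \<partial>cp)"
    using nn_integral_M_obs[of "indicator B" k "\<lambda>_. 1"] by simp
  finally show ?thesis by simp
qed

text \<open>On the set where the posterior is not positive, "no change" has probability 0, so the
  data set \<open>B\<close> behind it is null for \<open>Pinf k\<close>. All data laws have
  densities with respect to \<open>Pinf k\<close>, hence the set is null in the model too. This
  legitimises the division in \<open>qstat\<close>.\<close>

lemma post_1_pos: "AE \<omega> in M. 0 < post L rho N f0 f1 k 1 \<omega>"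
proof -
  interpret prob_space M by (rule prob_M)
  interpret sigma_finite_subalgebra M "F k" by (rule sigma_finite_F)
  let ?E = "cp_event L k 1"
  define A where "A = {\<omega>\<in>space M. post L rho N f0 f1 k 1 \<omega> \<le> 0}"
  have "{\<omega>\<in>space (F k). post L rho N f0 f1 k 1 \<omega> \<le> 0} \<in> sets (F k)" by measurable
  then have AF: "A \<in> sets (F k)" by (simp add: A_def)
  then obtain B where B [measurable]: "B \<in> sets (PiM (J k) (\<lambda>_. N))" and A: "A = {\<omega>\<in>space M. obs k \<omega> \<in> B}"
    by (auto simp: sets_F_iff)
  have AM [measurable]: "A \<in> sets M" using AF subalgebra_F by (auto simp: subalgebra_def)
  have int: "integrable M (\<lambda>\<omega>. indicator A \<omega> * indicator ?E \<omega> :: real)"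
    using integrable_mult_indicator[OF AM integrable_cp_event] by simp
  have "(\<integral>\<omega>. indicator A \<omega> * indicator ?E \<omega> \<partial>M) = (\<integral>\<omega>\<in>A. post L rho N f0 f1 k 1 \<omega> \<partial>M)"
    using real_cond_exp_intA[OF integrable_cp_event AF, of k 1] by (simp add: post_def set_lebesgue_integral_def)
  also have "\<dots> \<le> 0"
  proof -
    have "0 \<le> (\<integral>\<omega>. - (indicator A \<omega> * post L rho N f0 f1 k 1 \<omega>) \<partial>M)"
      by (intro integral_nonneg_AE) (auto simp: A_def indicator_def)
    then show ?thesis by (simp add: set_lebesgue_integral_def)
  qed
  finally have "(\<integral>\<omega>. indicator A \<omega> * indicator ?E \<omega> \<partial>M) = (0::real)"
    by (intro antisym integral_nonneg_AE) auto
  then have "(\<integral>\<^sup>+\<omega>. ennreal (indicator A \<omega> * indicator ?E \<omega>) \<partial>M) = 0"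
    by (subst nn_integral_eq_integral[OF int]) auto
  also have "(\<integral>\<^sup>+\<omega>. ennreal (indicator A \<omega> * indicator ?E \<omega>) \<partial>M) = (\<integral>\<^sup>+\<omega>. indicator ?E \<omega> * indicator B (obs k \<omega>) \<partial>M)"
    by (intro nn_integral_cong) (auto simp: indicator_def A)
  also have "\<dots> = ennreal ((1 - rho 1) ^ Suc k) * (\<integral>\<^sup>+ y. indicator B y \<partial>Pinf k)"
    by (rule nn_integral_no_change) measurable
  finally have "emeasure (Pinf k) B = 0"
    using zero_less_power[of "1 - rho 1" "Suc k"] rho1 by (auto simp: ennreal_eq_0_iff simp del: power_Suc zero_less_power)
  then have "AE y in Pinf k. y \<notin> B" by (intro AE_not_in null_setsI) auto
  then have "(\<integral>\<^sup>+ y. Lik g k y * indicator B y \<partial>Pinf k) = 0" for g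
    by (subst nn_integral_0_iff_AE) (auto elim!: eventually_mono)
  then have "emeasure M A = 0" unfolding A by (subst emeasure_M_obs) auto
  then have "AE \<omega> in M. \<omega> \<notin> A" by (intro AE_not_in null_setsI AM) auto
  then show ?thesis using AE_space by eventually_elim (auto simp: A_def)
qed


section \<open>Real-valued likelihoods and Bayes' rule\<close>

definition likr :: "(nat \<Rightarrow> nat) \<Rightarrow> nat \<Rightarrow> (nat \<times> nat \<Rightarrow> 'a) \<Rightarrow> real" where
  "likr g k z = (\<Prod>i\<in>J k. if fst i < g (snd i) then 1 else lr (z i))"

lemma likr_measurable [measurable]: "likr g k \<in> borel_measurable (PiM (J k) (\<lambda>_. N))"
  unfolding likr_def by measurable

lemma likr_nonneg: "z \<in> space (PiM (J k) (\<lambda>_. N)) \<Longrightarrow> 0 \<le> likr g k z"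
  unfolding likr_def by (intro prod_nonneg) (auto simp: space_PiM PiE_iff intro!: lr_nonneg)

lemma Lik_eq_likr: "z \<in> space (PiM (J k) (\<lambda>_. N)) \<Longrightarrow> Lik g k z = ennreal (likr g k z)"
  unfolding likr_def Lik_def
  by (subst prod_ennreal[symmetric]) (auto simp: space_PiM PiE_iff intro!: prod.cong lr_nonneg)

lemma obs_in_space: "\<omega> \<in> space M \<Longrightarrow> obs k \<omega> \<in> space (PiM (J k) (\<lambda>_. N))"
  using measurable_space[OF obs_M_measurable] .

lemma nn_integral_Lik: "(\<integral>\<^sup>+ y. Lik g k y \<partial>Pinf k) = 1"
proof -
  interpret prob_space "P g" by (rule prob_P)
  show ?thesis using nn_integral_P_obs[of "\<lambda>_. 1" k g] by (simp add: emeasure_space_1[unfolded space_P])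
qed

text \<open>The value 0 off \<open>{1..L}\<close> is the default left by \<open>cp_pmf\<close>; any
  other value there would give this configuration mass 0.\<close>

definition simul :: "nat \<Rightarrow> nat \<Rightarrow> nat" where
  "simul m = (\<lambda>l. if l \<in> {1..L} then m else 0)"

text \<open>Bayes' rule, restricted to the hypothesis that all streams change at time \<open>m\<close>.\<close>

lemma post_1_upper:
  assumes mk: "m \<le> k"
  shows "AE \<omega> in M. pmf cp (simul m) * likr (simul m) k (obs k \<omega>) * post L rho N f0 f1 k 1 \<omega>
    \<le> (1 - rho 1) ^ Suc k * (1 - post L rho N f0 f1 k 1 \<omega>)"
proof -
  interpret prob_space M by (rule prob_M)
  interpret sigma_finite_subalgebra M "F k" by (rule sigma_finite_F)
  let ?E = "cp_event L k 1" and ?c = "(1 - rho 1) ^ Suc k"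
  define U where "U \<omega> = pmf cp (simul m) * likr (simul m) k (obs k \<omega>)" for \<omega> :: "(nat \<Rightarrow> nat) \<times> (nat \<times> nat \<Rightarrow> 'a)"
  have UF [measurable]: "U \<in> borel_measurable (F k)" unfolding U_def by measurable
  have UM [measurable]: "U \<in> borel_measurable M" unfolding U_def by measurable
  have Unn: "0 \<le> U \<omega>" if "\<omega> \<in> space M" for \<omega>
    unfolding U_def using likr_nonneg[OF obs_in_space[OF that]] by simp
  have c: "0 < ?c" using rho1 by simp
  \<comment> \<open>Given no change the data follow \<open>Pinf k\<close>; weighting by the
    likelihood turns this into the law for \<open>simul m\<close>. Both sides are therefore
    \<open>?c\<close> times the probability that the change-points equal \<open>simul m\<close> and
    the data lie in \<open>B\<close>.\<close>
  have UB: "(\<integral>\<^sup>+ \<omega>. ennreal (indicator A \<omega> * (U \<omega> * indicator ?E \<omega>)) \<partial>M)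
      = ennreal ?c * (ennreal (pmf cp (simul m)) * (\<integral>\<^sup>+ y. Lik (simul m) k y * indicator B y \<partial>Pinf k))"
    if B [measurable]: "B \<in> sets (PiM (J k) (\<lambda>_. N))" and A: "A = {\<omega>\<in>space M. obs k \<omega> \<in> B}" for A B
  proof -
    have "(\<integral>\<^sup>+ \<omega>. ennreal (indicator A \<omega> * (U \<omega> * indicator ?E \<omega>)) \<partial>M)
      = (\<integral>\<^sup>+ \<omega>. indicator ?E \<omega> * (ennreal (pmf cp (simul m)) * (Lik (simul m) k (obs k \<omega>) * indicator B (obs k \<omega>))) \<partial>M)"
      using likr_nonneg[OF obs_in_space]
      by (intro nn_integral_cong) (auto simp: A indicator_def U_def Lik_eq_likr[OF obs_in_space] ennreal_mult)
    also have "\<dots> = ennreal ?c * (\<integral>\<^sup>+ y. ennreal (pmf cp (simul m)) * (Lik (simul m) k y * indicator B y) \<partial>Pinf k)"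
      by (rule nn_integral_no_change) measurable
    finally show ?thesis by (simp add: nn_integral_cmult)
  qed
  have intUE: "integrable M (\<lambda>\<omega>. U \<omega> * indicator ?E \<omega>)"
  proof (rule integrableI_nonneg)
    have "(\<integral>\<^sup>+ \<omega>. ennreal (U \<omega> * indicator ?E \<omega>) \<partial>M) = (\<integral>\<^sup>+ \<omega>. ennreal (indicator (space M) \<omega> * (U \<omega> * indicator ?E \<omega>)) \<partial>M)"
      by (intro nn_integral_cong) (auto simp: indicator_def)
    also have "\<dots> = ennreal ?c * (ennreal (pmf cp (simul m)) * (\<integral>\<^sup>+ y. Lik (simul m) k y * indicator (space (PiM (J k) (\<lambda>_. N))) y \<partial>Pinf k))"
      using obs_in_space by (intro UB) auto
    also have "(\<integral>\<^sup>+ y. Lik (simul m) k y * indicator (space (PiM (J k) (\<lambda>_. N))) y \<partial>Pinf k) = (\<integral>\<^sup>+ y. Lik (simul m) k y \<partial>Pinf k)"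
      by (intro nn_integral_cong) (auto simp: indicator_def)
    also have "\<dots> = 1" by (rule nn_integral_Lik)
    finally show "(\<integral>\<^sup>+ \<omega>. ennreal (U \<omega> * indicator ?E \<omega>) \<partial>M) < \<infinity>"
      by (simp add: ennreal_mult_less_top)
    show "(\<lambda>\<omega>. U \<omega> * indicator ?E \<omega>) \<in> borel_measurable M" by measurable
  qed (use Unn in \<open>auto simp: indicator_def\<close>)
  \<comment> \<open>The claim is that the conditional expectation of \<open>w\<close> is
    nonnegative: the indicators become posteriors and the observable \<open>U\<close> is pulled
    out.\<close>
  define w where "w \<omega> = ?c * (1 - indicator ?E \<omega>) - U \<omega> * indicator ?E \<omega>" for \<omega>
  have intE: "integrable M (\<lambda>\<omega>. 1 - indicator ?E \<omega> :: real)"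
    using integrable_cp_event by simp
  have intc: "integrable M (\<lambda>\<omega>. ?c * (1 - indicator ?E \<omega>) :: real)"
    using intE by (intro integrable_mult_right)
  have intw: "integrable M w"
    unfolding w_def using intc intUE by (intro Bochner_Integration.integrable_diff)
  have "AE \<omega> in M. 0 \<le> real_cond_exp M (F k) w \<omega>"
  proof (rule real_cond_exp_nonneg_AE[OF intw])
    fix A assume AF: "A \<in> sets (F k)"
    then obtain B where B [measurable]: "B \<in> sets (PiM (J k) (\<lambda>_. N))" and A: "A = {\<omega>\<in>space M. obs k \<omega> \<in> B}"
      by (auto simp: sets_F_iff)
    have AM [measurable]: "A \<in> sets M" using AF subalgebra_F by (auto simp: subalgebra_def)
    have i1: "integrable M (\<lambda>\<omega>. indicator A \<omega> * (?c * (1 - indicator ?E \<omega>)) :: real)"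
      using integrable_mult_indicator[OF AM intc] by simp
    have i2: "integrable M (\<lambda>\<omega>. indicator A \<omega> * (U \<omega> * indicator ?E \<omega>))"
      using integrable_mult_indicator[OF AM intUE] by simp
    have "ennreal (\<integral>\<omega>. indicator A \<omega> * (U \<omega> * indicator ?E \<omega>) \<partial>M) = (\<integral>\<^sup>+ \<omega>. ennreal (indicator A \<omega> * (U \<omega> * indicator ?E \<omega>)) \<partial>M)"
      using Unn by (intro nn_integral_eq_integral[symmetric] i2) (auto simp: indicator_def)
    also have "\<dots> = ennreal ?c * (ennreal (pmf cp (simul m)) * (\<integral>\<^sup>+ y. Lik (simul m) k y * indicator B y \<partial>Pinf k))"
      by (rule UB[OF B A])
    also have "ennreal (pmf cp (simul m)) * (\<integral>\<^sup>+ y. Lik (simul m) k y * indicator B y \<partial>Pinf k)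
        = (\<integral>\<^sup>+ g. indicator {simul m} g * (\<integral>\<^sup>+ y. Lik g k y * indicator B y \<partial>Pinf k) \<partial>cp)"
    proof -
      have "(\<integral>\<^sup>+ g. indicator {simul m} g * (\<integral>\<^sup>+ y. Lik g k y * indicator B y \<partial>Pinf k) \<partial>cp)
        = (\<integral>\<^sup>+ g. (\<integral>\<^sup>+ y. Lik (simul m) k y * indicator B y \<partial>Pinf k) * indicator {simul m} g \<partial>cp)"
        by (intro nn_integral_cong) (auto simp: indicator_def)
      then show ?thesis
        by (subst (asm) nn_integral_cmult_indicator) (auto simp: emeasure_pmf_single mult.commute)
    qed
    also have "\<dots> = (\<integral>\<^sup>+ \<omega>. indicator {simul m} (fst \<omega>) * indicator B (obs k \<omega>) \<partial>M)"
      by (rule nn_integral_M_obs[symmetric]) measurable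
    \<comment> \<open>A simultaneous change at \<open>m \<le> k\<close> is incompatible with "no
      change by \<open>k\<close>".\<close>
    also have "ennreal ?c * \<dots> \<le> ennreal ?c * (\<integral>\<^sup>+ \<omega>. ennreal (indicator A \<omega> * (1 - indicator ?E \<omega>)) \<partial>M)"
    proof (intro mult_left_mono nn_integral_mono)
      fix \<omega> assume "\<omega> \<in> space M"
      then show "indicator {simul m} (fst \<omega>) * indicator B (obs k \<omega>) \<le> ennreal (indicator A \<omega> * (1 - indicator ?E \<omega>))"
        using mk L by (auto simp: indicator_def A cp_event_def simul_def)
    qed simp
    also have "\<dots> = (\<integral>\<^sup>+ \<omega>. ennreal (indicator A \<omega> * (?c * (1 - indicator ?E \<omega>))) \<partial>M)"
    proof (subst nn_integral_cmult[symmetric])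
      show "(\<integral>\<^sup>+ \<omega>. ennreal ?c * ennreal (indicator A \<omega> * (1 - indicator ?E \<omega>)) \<partial>M) = (\<integral>\<^sup>+ \<omega>. ennreal (indicator A \<omega> * (?c * (1 - indicator ?E \<omega>))) \<partial>M)"
        using c by (intro nn_integral_cong) (auto simp: indicator_def)
    qed measurable
    also have "\<dots> = ennreal (\<integral>\<omega>. indicator A \<omega> * (?c * (1 - indicator ?E \<omega>)) \<partial>M)"
      using c by (intro nn_integral_eq_integral i1) (auto simp: indicator_def)
    finally have "(\<integral>\<omega>. indicator A \<omega> * (U \<omega> * indicator ?E \<omega>) \<partial>M) \<le> (\<integral>\<omega>. indicator A \<omega> * (?c * (1 - indicator ?E \<omega>)) \<partial>M)"
      using c by (subst (asm) ennreal_le_iff) (auto intro!: integral_nonneg_AE simp: indicator_def)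
    then show "0 \<le> (\<integral>\<omega>\<in>A. w \<omega> \<partial>M)"
      unfolding set_lebesgue_integral_def w_def
      using i1 i2 by (simp add: right_diff_distrib del: power_Suc)
  qed
  moreover have "AE \<omega> in M. real_cond_exp M (F k) w \<omega> =
      real_cond_exp M (F k) (\<lambda>\<omega>. ?c * (1 - indicator ?E \<omega>)) \<omega> - real_cond_exp M (F k) (\<lambda>\<omega>. U \<omega> * indicator ?E \<omega>) \<omega>"
    unfolding w_def by (rule real_cond_exp_diff[OF intc intUE])
  moreover have "AE \<omega> in M. real_cond_exp M (F k) (\<lambda>\<omega>. ?c * (1 - indicator ?E \<omega>)) \<omega> = ?c * real_cond_exp M (F k) (\<lambda>\<omega>. 1 - indicator ?E \<omega>) \<omega>"
    by (rule real_cond_exp_cmult[OF intE])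
  moreover have "AE \<omega> in M. real_cond_exp M (F k) (\<lambda>\<omega>. 1 - indicator ?E \<omega>) \<omega> =
     real_cond_exp M (F k) (\<lambda>_. 1) \<omega> - real_cond_exp M (F k) (indicator ?E) \<omega>"
    using integrable_cp_event by (intro real_cond_exp_diff) auto
  moreover have "AE \<omega> in M. real_cond_exp M (F k) (\<lambda>_. 1) \<omega> = 1"
    by (intro real_cond_exp_F_meas) auto
  moreover have "AE \<omega> in M. real_cond_exp M (F k) (\<lambda>\<omega>. U \<omega> * indicator ?E \<omega>) \<omega> = U \<omega> * real_cond_exp M (F k) (indicator ?E) \<omega>"
    using intUE by (intro real_cond_exp_mult) auto
  ultimately show ?thesis
    by eventually_elim (simp add: U_def post_def del: power_Suc)
qed

end

section \<open>First passage and a uniform weak law\<close>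

text \<open>Wald's identity for the stopped walk. \<open>E i\<close> depends only on the steps
  before \<open>i\<close>, so it is independent of \<open>X i\<close> and the stopped walk has mean
  \<open>c\<close> times the sum of the \<open>prob (E i)\<close>. It never exceeds
  \<open>b + B\<close>: it is at most \<open>b\<close> while it moves, and the step that leaves
  \<open>E\<close> adds at most \<open>B\<close>.\<close>

lemma (in prob_space) sum_prob_no_crossing_le:
  fixes X :: "nat \<Rightarrow> 'a \<Rightarrow> real"
  assumes indep: "indep_vars (\<lambda>_. borel) X UNIV"
    and int: "\<And>i. integrable M (X i)" and ex: "\<And>i. expectation (X i) = c" and c: "0 < c"
    and XB: "\<And>i \<omega>. X i \<omega> \<le> B" and B: "0 \<le> B" and b: "0 \<le> b"
  defines "E \<equiv> \<lambda>n. {\<omega>\<in>space M. \<forall>j\<in>{1..n}. (\<Sum>t<j. X t \<omega>) < b}"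
  shows "(\<Sum>i<n. prob (E i)) \<le> (b + B) / c"
proof -
  have [measurable]: "X i \<in> borel_measurable M" for i using int by auto
  have E_sets [measurable]: "E i \<in> events" for i unfolding E_def by measurable
  \<comment> \<open>the walk stopped when it leaves \<open>E\<close>\<close>
  define W where "W m \<omega> = (\<Sum>i<m. indicator (E i) \<omega> * X i \<omega>)" for m \<omega>
  have W_sum: "W m \<omega> = (\<Sum>i<m. X i \<omega>)" if "\<omega> \<in> E m" for m \<omega>
    unfolding W_def using that by (intro sum.cong refl) (auto simp: E_def)
  have W_le: "W m \<omega> \<le> b + B" for m \<omega>
  proof (induction m)
    case 0
    show ?case using b B by (simp add: W_def)
  next
    case (Suc m)
    show ?case
    proof (cases "\<omega> \<in> E m")
      case True
      have "(\<Sum>i<m. X i \<omega>) \<le> b"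
      proof (cases "m = 0")
        case False
        then have "m \<in> {1..m}" by auto
        then show ?thesis using True unfolding E_def by fastforce
      qed (use b in simp)
      then show ?thesis using W_sum[OF True] True XB[of m \<omega>] by (simp add: W_def)
    next
      case False
      then show ?thesis using Suc by (simp add: W_def)
    qed
  qed
  have iE: "integrable M (indicator (E i) :: 'a \<Rightarrow> real)" for i
    by (intro integrable_real_indicator) (auto simp: emeasure_eq_measure)
  have E_term: "expectation (\<lambda>\<omega>. indicator (E i) \<omega> * X i \<omega>) = prob (E i) * c
      \<and> integrable M (\<lambda>\<omega>. indicator (E i) \<omega> * X i \<omega>)" for i
  proof -
    \<comment> \<open>Written as a function of the first \<open>i\<close> steps, \<open>E i\<close>
      becomes accessible to the independence of disjoint blocks.\<close>
    let ?A = "{y \<in> space (PiM {..<i} (\<lambda>_. borel)). \<forall>j\<in>{1..i}. (\<Sum>t<j. y t) < b} :: (nat \<Rightarrow> real) set"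
    let ?G = "\<lambda>\<omega>. indicator ?A (restrict (\<lambda>i. X i \<omega>) {..<i}) :: real"
    have [measurable]: "(\<lambda>y. \<Sum>t<j. y t) \<in> borel_measurable (PiM {..<i} (\<lambda>_. borel :: real measure))" if "j \<in> {1..i}" for j
      using that by (intro borel_measurable_sum measurable_component_singleton) auto
    have A: "?A \<in> sets (PiM {..<i} (\<lambda>_. borel))" by measurable
    have "indep_var borel ((\<lambda>f. f i) \<circ> (\<lambda>\<omega>. restrict (\<lambda>i. X i \<omega>) {i}))
      borel (indicator ?A \<circ> (\<lambda>\<omega>. restrict (\<lambda>i. X i \<omega>) {..<i}) :: 'a \<Rightarrow> real)"
      by (intro indep_var_compose[OF indep_var_restrict[OF indep]] borel_measurable_indicator A) auto
    then have ind: "indep_var borel (X i) borel ?G"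
      by (simp add: o_def)
    have eq: "?G \<omega> = indicator (E i) \<omega>" if "\<omega> \<in> space M" for \<omega>
    proof -
      have "(\<Sum>t<j. restrict (\<lambda>i. X i \<omega>) {..<i} t) = (\<Sum>t<j. X t \<omega>)" if "j \<in> {1..i}" for j
        using that by (intro sum.cong) auto
      then show ?thesis using that by (auto simp: E_def indicator_def space_PiM)
    qed
    have iG: "integrable M ?G"
      using iE[of i] by (subst Bochner_Integration.integrable_cong[OF refl eq]) auto
    have "expectation ?G = prob (E i)"
      using Bochner_Integration.integral_cong[OF refl eq, of M "\<lambda>\<omega>. \<omega>"] by simp
    then have "expectation (\<lambda>\<omega>. X i \<omega> * ?G \<omega>) = prob (E i) * c" "integrable M (\<lambda>\<omega>. X i \<omega> * ?G \<omega>)"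
      using indep_var_lebesgue_integral[OF ind int iG] indep_var_integrable[OF ind int iG]
      by (simp_all add: ex mult.commute)
    moreover have G: "X i \<omega> * ?G \<omega> = indicator (E i) \<omega> * X i \<omega>" if "\<omega> \<in> space M" for \<omega>
      using eq[OF that] by simp
    have "expectation (\<lambda>\<omega>. X i \<omega> * ?G \<omega>) = expectation (\<lambda>\<omega>. indicator (E i) \<omega> * X i \<omega>)"
      by (intro Bochner_Integration.integral_cong refl G)
    moreover have "integrable M (\<lambda>\<omega>. X i \<omega> * ?G \<omega>) \<longleftrightarrow> integrable M (\<lambda>\<omega>. indicator (E i) \<omega> * X i \<omega>)"
      by (intro Bochner_Integration.integrable_cong refl G)
    ultimately show ?thesis by simp
  qed
  note term_eq = E_term[THEN conjunct1] and term_int = E_term[THEN conjunct2]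
  have "expectation (W n) = (\<Sum>i<n. expectation (\<lambda>\<omega>. indicator (E i) \<omega> * X i \<omega>))"
    unfolding W_def using term_int by (intro Bochner_Integration.integral_sum)
  also have "\<dots> = (\<Sum>i<n. prob (E i)) * c"
    unfolding term_eq sum_distrib_right ..
  finally have "expectation (W n) = (\<Sum>i<n. prob (E i)) * c" .
  moreover have "expectation (W n) \<le> b + B"
  proof -
    have "expectation (W n) \<le> expectation (\<lambda>_. b + B)"
      using W_le term_int unfolding W_def by (intro integral_mono Bochner_Integration.integrable_sum) auto
    then show ?thesis by (simp add: prob_space)
  qed
  ultimately show ?thesis using c by (simp add: field_simps)
qed

text \<open>Dominated convergence, with |x| as majorant. \<open>0 < B\<close> is demanded because
  the Hoeffding exponent later divides by the square of \<open>B\<close>.\<close>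

lemma truncation_L1:
  fixes Q :: "real measure"
  assumes [measurable_cong]: "sets Q = sets borel" and int: "integrable Q (\<lambda>x. x)" and e: "0 < e"
  obtains B :: nat where "integrable Q (\<lambda>x. \<bar>x - max (- real B) (min (real B) x)\<bar>)"
    "(\<integral>x. \<bar>x - max (- real B) (min (real B) x)\<bar> \<partial>Q) < e" "0 < B"
proof -
  have int': "integrable Q (\<lambda>x. \<bar>x - max (- real B) (min (real B) x)\<bar>)" for B
    by (rule Bochner_Integration.integrable_bound[OF integrable_abs[OF int]]) auto
  have "(\<lambda>B. \<integral>x. \<bar>x - max (- real B) (min (real B) x)\<bar> \<partial>Q) \<longlonglongrightarrow> (\<integral>x. 0 \<partial>Q)"
  proof (rule integral_dominated_convergence[OF _ _ integrable_abs[OF int]])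
    show "AE x in Q. (\<lambda>B. \<bar>x - max (- real B) (min (real B) x)\<bar>) \<longlonglongrightarrow> 0"
    proof (rule AE_I2)
      fix x :: real
      have "eventually (\<lambda>B. \<bar>x\<bar> \<le> real B) sequentially"
        by (rule eventually_sequentiallyI[of "nat \<lceil>\<bar>x\<bar>\<rceil>"]) linarith
      then have "eventually (\<lambda>B. \<bar>x - max (- real B) (min (real B) x)\<bar> = 0) sequentially"
        by eventually_elim auto
      then show "(\<lambda>B. \<bar>x - max (- real B) (min (real B) x)\<bar>) \<longlonglongrightarrow> 0"
        by (rule tendsto_eventually)
    qed
    show "AE x in Q. norm \<bar>x - max (- real B) (min (real B) x)\<bar> \<le> \<bar>x\<bar>" for B by auto
  qed auto
  then have "eventually (\<lambda>B. (\<integral>x. \<bar>x - max (- real B) (min (real B) x)\<bar> \<partial>Q) < e) sequentially"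
    using e by (intro order_tendstoD(2)) auto
  then have "eventually (\<lambda>B. (\<integral>x. \<bar>x - max (- real B) (min (real B) x)\<bar> \<partial>Q) < e \<and> 0 < B) sequentially"
    using eventually_gt_at_top[of 0] by eventually_elim auto
  then obtain B :: nat where "(\<integral>x. \<bar>x - max (- real B) (min (real B) x)\<bar> \<partial>Q) < e" "0 < B"
    by (auto simp: eventually_sequentially)
  then show ?thesis using that int' by blast
qed

text \<open>\<open>K0\<close> depends on \<open>Q\<close>, \<open>c\<close>, \<open>e\<close>,
  \<open>d\<close> only, not on the probability space, the index set or the family. The allowance
  \<open>e * K\<close> is measured in \<open>K\<close> rather than in \<open>card I\<close>, so
  small index sets do no harm. Truncated variables are handled by Hoeffding, the remainders by
  Markov.\<close>

lemma weak_law_uniform: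
  fixes Q :: "real measure" and c :: nat
  assumes Q: "prob_space Q" and sQ [measurable_cong]: "sets Q = sets borel" and int: "integrable Q (\<lambda>x. x)"
    and e: "0 < e" and d: "0 < d"
  obtains K0 :: nat where "\<And>K (M :: 'm measure) (I :: 'i set) X. K0 \<le> K \<Longrightarrow> prob_space M \<Longrightarrow> finite I \<Longrightarrow> card I \<le> c * K \<Longrightarrow>
     prob_space.indep_vars M (\<lambda>_. borel) X I \<Longrightarrow> (\<And>i. i \<in> I \<Longrightarrow> distr M borel (X i) = Q) \<Longrightarrow>
     measure M {\<omega>\<in>space M. real (card I) * (\<integral>x. x \<partial>Q) + e * real K \<le> (\<Sum>i\<in>I. X i \<omega>)} \<le> d"
proof -
  interpret Q: prob_space Q by (rule Q)
  \<comment> \<open>\<open>Suc c\<close> keeps the divisor positive when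
    \<open>c = 0\<close>.\<close>
  define c' where "c' = real (Suc c)"
  have c': "0 < c'" "real c \<le> c'" by (auto simp: c'_def)
  \<comment> \<open>The first entry keeps the change of centring caused by truncation below
    \<open>e * K / 4\<close>; the second makes the Markov bound at most
    \<open>d / 2\<close>.\<close>
  define h where "h = min (e / (4 * c')) (d * e / (8 * c'))"
  have h: "0 < h" using e d c' by (simp add: h_def)
  obtain B :: nat where intB: "integrable Q (\<lambda>x. \<bar>x - max (- real B) (min (real B) x)\<bar>)"
    and B: "(\<integral>x. \<bar>x - max (- real B) (min (real B) x)\<bar> \<partial>Q) < h" and B0: "0 < B"
    using truncation_L1[OF sQ int h] .
  define T where "T x = max (- real B) (min (real B) x)" for x :: real
  have T_bd: "\<bar>T x\<bar> \<le> real B" for x by (auto simp: T_def)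
  have [measurable]: "T \<in> borel_measurable borel" unfolding T_def by measurable
  have intT: "integrable Q T"
    by (intro Q.integrable_const_bound[where B="real B"]) (use T_bd in auto)
  have intXT: "integrable Q (\<lambda>x. x - T x)" using int intT by auto
  have absXT: "(\<integral>x. \<bar>x - T x\<bar> \<partial>Q) < h" using B by (simp add: T_def)
  define \<mu> where "\<mu> = (\<integral>x. x \<partial>Q)"
  define \<mu>T where "\<mu>T = (\<integral>x. T x \<partial>Q)"
  have \<mu>: "\<bar>\<mu> - \<mu>T\<bar> < h"
  proof -
    have "\<bar>\<mu> - \<mu>T\<bar> = \<bar>\<integral>x. x - T x \<partial>Q\<bar>" using int intT by (simp add: \<mu>_def \<mu>T_def)
    also have "\<dots> \<le> (\<integral>x. \<bar>x - T x\<bar> \<partial>Q)" by (rule integral_abs_bound)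
    finally show ?thesis using absXT by simp
  qed
  \<comment> \<open>The Hoeffding bound in the worst case: deviation \<open>e * K / 2\<close>, at
    most \<open>c' * K\<close> summands, each of range \<open>2 * B\<close>.\<close>
  have "((\<lambda>K. exp (- (e\<^sup>2 / (8 * c' * (real B)\<^sup>2)) * real K)) \<longlongrightarrow> 0) sequentially"
    using e c' B0 by real_asymp
  then have "eventually (\<lambda>K. exp (- (e\<^sup>2 / (8 * c' * (real B)\<^sup>2)) * real K) < d / 2) sequentially"
    using d by (intro order_tendstoD(2)) auto
  then obtain K0 where K0: "\<And>K. K0 \<le> K \<Longrightarrow> exp (- (e\<^sup>2 / (8 * c' * (real B)\<^sup>2)) * real K) < d / 2"
    by (auto simp: eventually_sequentially)
  show ?thesis
  proof (rule that[of "max 1 K0"])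
    fix K and M :: "'m measure" and I :: "'i set" and X
    assume K: "max 1 K0 \<le> K" and M: "prob_space M" and I: "finite I" "card I \<le> c * K"
      and indep: "prob_space.indep_vars M (\<lambda>_. borel) X I"
      and X: "\<And>i. i \<in> I \<Longrightarrow> distr M borel (X i) = Q"
    interpret M: prob_space M by (rule M)
    have Xm [measurable]: "X i \<in> borel_measurable M" if "i \<in> I" for i
      using indep that by (simp add: M.indep_vars_def)
    have K1: "1 \<le> real K" using K by simp
    have n: "real (card I) \<le> c' * real K"
    proof -
      have "real (card I) \<le> real c * real K" using I(2) by (metis of_nat_le_iff of_nat_mult)
      also have "\<dots> \<le> c' * real K" using c' by (intro mult_right_mono) auto
      finally show ?thesis .
    qed
    show "measure M {\<omega>\<in>space M. real (card I) * (\<integral>x. x \<partial>Q) + e * real K \<le> (\<Sum>i\<in>I. X i \<omega>)} \<le> d"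
    proof (cases "I = {}")
      case True
      have "0 < e * real K" using e K1 by simp
      with True show ?thesis using d by (simp add: not_le[symmetric])
    next
      case False
      then have n0: "0 < real (card I)" using I by (simp add: card_gt_0_iff)
      let ?A = "{\<omega>\<in>space M. real (card I) * \<mu>T + e * real K / 2 \<le> (\<Sum>i\<in>I. T (X i \<omega>))}"
      let ?C = "{\<omega>\<in>space M. e * real K / 4 \<le> (\<Sum>i\<in>I. \<bar>X i \<omega> - T (X i \<omega>)\<bar>)}"
      have TX_ex: "M.expectation (\<lambda>\<omega>. T (X i \<omega>)) = \<mu>T" if "i \<in> I" for i
        unfolding \<mu>T_def X[OF that, symmetric] using that by (subst integral_distr) auto
      have XT_int: "integrable M (\<lambda>\<omega>. \<bar>X i \<omega> - T (X i \<omega>)\<bar>)" if "i \<in> I" for i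
      proof -
        have "integrable (distr M borel (X i)) (\<lambda>x. \<bar>x - T x\<bar>)"
          unfolding X[OF that] using intB by (simp add: T_def)
        then show ?thesis using that by (subst (asm) integrable_distr_eq) auto
      qed
      have XT_ex: "M.expectation (\<lambda>\<omega>. \<bar>X i \<omega> - T (X i \<omega>)\<bar>) \<le> h" if "i \<in> I" for i
      proof -
        have "M.expectation (\<lambda>\<omega>. \<bar>X i \<omega> - T (X i \<omega>)\<bar>) = (\<integral>x. \<bar>x - T x\<bar> \<partial>Q)"
          unfolding X[OF that, symmetric] using that by (subst integral_distr) auto
        then show ?thesis using absXT by simp
      qed
      have A: "measure M ?A \<le> d / 2"
      proof -
        define t where "t = e * real K / 2"
        have t: "0 < t" using e K1 by (simp add: t_def)
        interpret H: Hoeffding_ineq M I "\<lambda>i \<omega>. T (X i \<omega>)" "\<lambda>_. - real B" "\<lambda>_. real B" "\<Sum>i\<in>I. M.expectation (\<lambda>\<omega>. T (X i \<omega>))"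
          using I T_bd by unfold_locales
            (auto intro!: M.indep_vars_compose2[OF indep, where Y="\<lambda>_. T"] AE_I2 simp: abs_le_iff minus_le_iff)
        have eq: "(\<Sum>i\<in>I. M.expectation (\<lambda>\<omega>. T (X i \<omega>))) = real (card I) * \<mu>T"
          using TX_ex by simp
        have s: "(\<Sum>i\<in>I. (real B - - real B)\<^sup>2) = real (card I) * (4 * (real B)\<^sup>2)"
          by (simp add: power2_eq_square)
        have s0: "0 < real (card I) * (4 * (real B)\<^sup>2)" using n0 B0 by simp
        have "measure M ?A \<le> exp (- 2 * t\<^sup>2 / (real (card I) * (4 * (real B)\<^sup>2)))"
          using H.Hoeffding_ineq_ge[of t] t s0 unfolding eq s by (simp add: t_def)
        also have "\<dots> \<le> exp (- 2 * t\<^sup>2 / (c' * real K * (4 * (real B)\<^sup>2)))"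
        proof -
          have "2 * t\<^sup>2 / (c' * real K * (4 * (real B)\<^sup>2)) \<le> 2 * t\<^sup>2 / (real (card I) * (4 * (real B)\<^sup>2))"
            using s0 n n0 c' K1 B0 by (intro divide_left_mono mult_right_mono mult_pos_pos) auto
          then show ?thesis by simp
        qed
        also have "- 2 * t\<^sup>2 / (c' * real K * (4 * (real B)\<^sup>2)) = - (e\<^sup>2 / (8 * c' * (real B)\<^sup>2)) * real K"
          using K1 c' B0 by (simp add: t_def field_simps power2_eq_square)
        also have "exp \<dots> < d / 2" using K0[of K] K by simp
        finally show ?thesis by simp
      qed
      have C: "measure M ?C \<le> d / 2"
      proof -
        have int_sum: "integrable M (\<lambda>\<omega>. \<Sum>i\<in>I. \<bar>X i \<omega> - T (X i \<omega>)\<bar>)"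
          using XT_int by (intro Bochner_Integration.integrable_sum)
        have "measure M ?C \<le> M.expectation (\<lambda>\<omega>. \<Sum>i\<in>I. \<bar>X i \<omega> - T (X i \<omega>)\<bar>) / (e * real K / 4)"
          using e K1 by (intro integral_Markov_inequality_measure[OF int_sum, of "space M"]) (auto simp: sum_nonneg)
        also have "M.expectation (\<lambda>\<omega>. \<Sum>i\<in>I. \<bar>X i \<omega> - T (X i \<omega>)\<bar>) = (\<Sum>i\<in>I. M.expectation (\<lambda>\<omega>. \<bar>X i \<omega> - T (X i \<omega>)\<bar>))"
          using XT_int by (intro Bochner_Integration.integral_sum)
        also have "\<dots> / (e * real K / 4) \<le> real (card I) * h / (e * real K / 4)"
          using XT_ex e K1 by (intro divide_right_mono sum_bounded_above[of I _ h]) auto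
        also have "\<dots> \<le> c' * real K * h / (e * real K / 4)"
          using n h e K1 by (intro divide_right_mono mult_right_mono) auto
        also have "\<dots> = 4 * c' * h / e" using K1 e by (simp add: field_simps)
        also have "\<dots> \<le> 4 * c' * (d * e / (8 * c')) / e"
          using e c' by (intro divide_right_mono mult_left_mono) (auto simp: h_def)
        also have "\<dots> = d / 2" using e c' by simp
        finally show ?thesis .
      qed
      \<comment> \<open>The allowance \<open>e * K\<close> is spent as one half on the truncated
        sum, one quarter on the remainders and one quarter on the change of centring.\<close>
      have "{\<omega>\<in>space M. real (card I) * (\<integral>x. x \<partial>Q) + e * real K \<le> (\<Sum>i\<in>I. X i \<omega>)} \<subseteq> ?A \<union> ?C"
      proof (rule subsetI, rule ccontr)
        fix \<omega> assume 1: "\<omega> \<in> {\<omega>\<in>space M. real (card I) * (\<integral>x. x \<partial>Q) + e * real K \<le> (\<Sum>i\<in>I. X i \<omega>)}" and 2: "\<omega> \<notin> ?A \<union> ?C"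
        have "(\<Sum>i\<in>I. X i \<omega>) = (\<Sum>i\<in>I. T (X i \<omega>)) + (\<Sum>i\<in>I. X i \<omega> - T (X i \<omega>))"
          by (simp add: sum_subtractf)
        also have "(\<Sum>i\<in>I. X i \<omega> - T (X i \<omega>)) \<le> (\<Sum>i\<in>I. \<bar>X i \<omega> - T (X i \<omega>)\<bar>)"
          by (intro sum_mono) auto
        finally have 3: "(\<Sum>i\<in>I. X i \<omega>) < real (card I) * \<mu>T + e * real K / 2 + e * real K / 4"
          using 1 2 by auto
        have "real (card I) * \<mu>T \<le> real (card I) * (\<mu> + h)"
          using \<mu> by (intro mult_left_mono) auto
        also have "\<dots> = real (card I) * \<mu> + real (card I) * h" by (simp add: distrib_left)
        also have "real (card I) * h \<le> (c' * real K) * (e / (4 * c'))"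
          using n h e c' K1 by (intro mult_mono) (auto simp: h_def)
        also have "\<dots> = e * real K / 4" using c' by (simp add: field_simps)
        finally show False using 1 3 by (auto simp: \<mu>_def)
      qed
      then have "measure M {\<omega>\<in>space M. real (card I) * (\<integral>x. x \<partial>Q) + e * real K \<le> (\<Sum>i\<in>I. X i \<omega>)} \<le> measure M (?A \<union> ?C)"
        by (intro M.finite_measure_mono) measurable
      also have "\<dots> \<le> measure M ?A + measure M ?C"
        by (intro measure_Un_le) measurable
      finally show ?thesis using A C by simp
    qed
  qed
qed

section \<open>Upper bound for the expected stopping time\<close>

lemma ennreal_of_enat_suminf: "ennreal_of_enat x = (\<Sum>k. indicator {k. enat k < x} k)"
proof (cases x)
  case (enat n)
  have "(\<Sum>k. indicator {k. k < n} k :: ennreal) = (\<Sum>k\<in>{..<n}. indicator {k. k < n} k)"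
    by (rule suminf_finite) (auto simp: indicator_def)
  then show ?thesis using enat by simp
next
  case infinity
  have "(\<Sum>k. 1::ennreal) = \<infinity>"
    using nn_integral_count_space_nat[of "\<lambda>_. 1"] by simp
  then show ?thesis using infinity by simp
qed

text \<open>Tail-sum formula after conceding the first \<open>m\<close> time units; its terms are
  the non-crossing events of a walk started at \<open>m\<close>.\<close>

lemma ennreal_of_enat_le_suminf:
  "ennreal_of_enat x \<le> of_nat m + (\<Sum>k. indicator {k. enat (m + k) < x} k)"
proof -
  have "x \<le> enat m + (x - enat m)" by (cases x) auto
  then have "ennreal_of_enat x \<le> of_nat m + ennreal_of_enat (x - enat m)"
    by (metis ennreal_of_enat_enat ennreal_of_enat_le_iff ennreal_of_enat_plus)
  also have "{k. enat (m + k) < x} = {k. enat k < x - enat m}" by (cases x) auto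
  then have "ennreal_of_enat (x - enat m) = (\<Sum>k. indicator {k. enat (m + k) < x} k)"
    by (simp add: ennreal_of_enat_suminf)
  finally show ?thesis .
qed

lemma borel_measurable_ennreal_of_enat:
  assumes "\<And>k. {\<omega>\<in>space M. enat k < t \<omega>} \<in> sets M"
  shows "(\<lambda>\<omega>. ennreal_of_enat (t \<omega>)) \<in> borel_measurable M"
proof -
  have [measurable]: "{\<omega>\<in>space M. enat k < t \<omega>} \<in> sets M" for k by (rule assms)
  have "(\<lambda>\<omega>. (\<Sum>k. indicator {\<omega>\<in>space M. enat k < t \<omega>} \<omega>) :: ennreal) \<in> borel_measurable M"
    by measurable
  also have "?this \<longleftrightarrow> ?thesis"
    by (intro measurable_cong) (simp add: ennreal_of_enat_suminf, simp add: indicator_def)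
  finally show ?thesis .
qed

context multistream begin

abbreviation "\<nu> \<equiv> nu L rho N f0 f1"
abbreviation "Q k \<omega> \<equiv> (\<Sum>l=2..L+1. qstat L rho N f0 f1 k l \<omega>)"

definition \<kappa> :: real where "\<kappa> = - ln (1 - rho 1)"

text \<open>Log-likelihood gain of one time unit after all changes. The summand
  \<open>\<kappa>\<close> is the gain from one further factor \<open>1 - rho 1\<close> in the
  no-change probability.\<close>

definition step :: "nat \<Rightarrow> (nat \<times> nat \<Rightarrow> 'a) \<Rightarrow> real" where
  "step i z = (\<Sum>l=1..L. ln (lr (z (i, l)))) + \<kappa>"

text \<open>Price of keeping a single configuration. The factor \<open>rho 1\<close> cancels against
  the normalisation in \<open>qstat\<close>, leaving the product over
  \<open>l \<ge> 2\<close>.\<close>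

definition C0 :: real where "C0 = (\<Prod>l=1..L. rho l) / rho 1"

lemma nu_le_iff: "\<nu> A \<omega> \<le> enat k \<longleftrightarrow> (\<exists>j\<le>k. A \<le> ln (Q j \<omega>))"
proof -
  let ?P = "\<lambda>k. A \<le> ln (Q k \<omega>)"
  show ?thesis
  proof (cases "\<exists>j. ?P j")
    case True
    then have "\<nu> A \<omega> = enat (LEAST j. ?P j)" by (auto simp: nu_def Let_def)
    moreover have "(LEAST j. ?P j) \<le> k \<longleftrightarrow> (\<exists>j\<le>k. ?P j)"
      using True by (meson LeastI_ex Least_le order.trans)
    ultimately show ?thesis by simp
  next
    case False
    then have "\<nu> A \<omega> = \<infinity>" by (auto simp: nu_def Let_def)
    then show ?thesis using False by auto
  qed
qed

lemma obs_stopping_time_nu: "obs_stopping_time L rho N f0 f1 (\<nu> A)"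
  unfolding obs_stopping_time_def
proof
  fix k
  have "{\<omega>\<in>space M. A \<le> ln (Q j \<omega>)} \<in> sets (F k)" if "j \<le> k" for j
  proof -
    have "{\<omega>\<in>space (F j). A \<le> ln (Q j \<omega>)} \<in> sets (F j)"
      unfolding qstat_def by measurable
    then show ?thesis using F_mono[OF that] unfolding space_F by (rule subsetD[rotated])
  qed
  then have "(\<Union>j\<in>{..k}. {\<omega>\<in>space M. A \<le> ln (Q j \<omega>)}) \<in> sets (F k)"
    by (intro sets.finite_UN) (simp_all only: finite_atMost atMost_iff)
  also have "(\<Union>j\<in>{..k}. {\<omega>\<in>space M. A \<le> ln (Q j \<omega>)}) = {\<omega>\<in>space M. \<nu> A \<omega> \<le> enat k}"
    unfolding nu_le_iff by blast
  finally show "{\<omega>\<in>space M. \<nu> A \<omega> \<le> enat k} \<in> sets (F k)" .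
qed

lemma stopping_time_sets:
  assumes "obs_stopping_time L rho N f0 f1 \<tau>"
  shows "{\<omega>\<in>space M. \<tau> \<omega> \<le> enat k} \<in> sets (F k)" "{\<omega>\<in>space M. \<tau> \<omega> \<le> enat k} \<in> sets M"
    "{\<omega>\<in>space M. enat k < \<tau> \<omega>} \<in> sets M"
proof -
  show 1: "{\<omega>\<in>space M. \<tau> \<omega> \<le> enat k} \<in> sets (F k)" using assms by (auto simp: obs_stopping_time_def)
  then show 2: "{\<omega>\<in>space M. \<tau> \<omega> \<le> enat k} \<in> sets M"
    using subalgebra_F[of k] by (auto simp: subalgebra_def)
  have "space M - {\<omega>\<in>space M. \<tau> \<omega> \<le> enat k} \<in> sets M" using 2 by (intro sets.compl_sets)
  also have "space M - {\<omega>\<in>space M. \<tau> \<omega> \<le> enat k} = {\<omega>\<in>space M. enat k < \<tau> \<omega>}"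
    by (auto simp: not_le)
  finally show "{\<omega>\<in>space M. enat k < \<tau> \<omega>} \<in> sets M" .
qed

lemma C0_pos: "0 < C0" and C0_le: "C0 \<le> 1"
proof -
  have "(\<Prod>l=1..L. rho l) = rho 1 * (\<Prod>l=2..L. rho l)"
  proof -
    have "{1..L} = insert 1 {2..L}" using L by auto
    then show ?thesis by simp
  qed
  then have "C0 = (\<Prod>l=2..L. rho l)" using rho1 by (simp add: C0_def)
  moreover have "0 < (\<Prod>l=2..L. rho l)" using rho by (intro prod_pos) auto
  moreover have "(\<Prod>l=2..L. rho l) \<le> 1" using rho by (intro prod_le_1) (auto intro: less_imp_le)
  ultimately show "0 < C0" "C0 \<le> 1" by auto
qed

lemma ln_C0_le: "ln C0 \<le> 0"
  using C0_pos C0_le by simp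

lemma kappa_pos: "0 < \<kappa>"
  using rho1 by (simp add: \<kappa>_def ln_less_zero)

lemma Q_eq:
  assumes "(\<Sum>l=2..L+1. post L rho N f0 f1 k l \<omega>) = 1 - post L rho N f0 f1 k 1 \<omega>"
  shows "Q k \<omega> = (1 - post L rho N f0 f1 k 1 \<omega>) / (rho 1 * post L rho N f0 f1 k 1 \<omega>)"
  unfolding qstat_def sum_divide_distrib[symmetric] using assms by simp

lemma likr_simul:
  assumes "1 \<le> m" "m \<le> k" and pos: "\<And>i l. i \<in> {m..k} \<Longrightarrow> l \<in> {1..L} \<Longrightarrow> 0 < lr (snd \<omega> (i, l))"
  shows "likr (simul m) k (obs k \<omega>) = exp (\<Sum>i=m..k. \<Sum>l=1..L. ln (lr (snd \<omega> (i, l))))"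
proof -
  have "likr (simul m) k (obs k \<omega>) = (\<Prod>i\<in>{m..k} \<times> {1..L}. lr (snd \<omega> i))"
    unfolding likr_def
  proof (rule prod.mono_neutral_cong_right)
    show "{m..k} \<times> {1..L} \<subseteq> J k" using assms by (auto simp: J_def)
  qed (use assms in \<open>auto simp: J_def simul_def\<close>)
  also have "\<dots> = (\<Prod>i\<in>{m..k} \<times> {1..L}. exp (ln (lr (snd \<omega> i))))"
    using pos by (intro prod.cong refl) auto
  also have "\<dots> = exp (\<Sum>i\<in>{m..k} \<times> {1..L}. ln (lr (snd \<omega> i)))"
    by (simp add: exp_sum)
  also have "(\<Sum>i\<in>{m..k} \<times> {1..L}. ln (lr (snd \<omega> i))) = (\<Sum>i=m..k. \<Sum>l=1..L. ln (lr (snd \<omega> (i, l))))"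
    by (simp add: sum.cartesian_product)
  finally show ?thesis .
qed

text \<open>The quantifiers over \<open>m\<close> and \<open>k\<close> stand inside the
  almost-everywhere statement, since the start of the walk depends on the change-points and its
  crossing time on the data. The bound itself is \<open>post_1_upper\<close> rewritten in terms of
  \<open>Q\<close>.\<close>

lemma nu_le_if_walk_crosses:
  "AE \<omega> in M. \<forall>m k. 1 \<le> m \<longrightarrow> m \<le> k \<longrightarrow> (\<forall>i\<in>{m..k}. \<forall>l\<in>{1..L}. 0 < lr (snd \<omega> (i, l))) \<longrightarrow>
     A \<le> ln C0 + (\<Sum>i=m..k. step i (snd \<omega>)) \<longrightarrow> \<nu> A \<omega> \<le> enat k"
proof -
  have "AE \<omega> in M. \<forall>k. (\<Sum>l=2..L+1. post L rho N f0 f1 k l \<omega>) = 1 - post L rho N f0 f1 k 1 \<omega>"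
    unfolding AE_all_countable using post_sum by simp
  moreover have "AE \<omega> in M. \<forall>k. 0 < post L rho N f0 f1 k 1 \<omega>"
    unfolding AE_all_countable using post_1_pos by simp
  moreover have "AE \<omega> in M. \<forall>m k. m \<le> k \<longrightarrow> pmf cp (simul m) * likr (simul m) k (obs k \<omega>) * post L rho N f0 f1 k 1 \<omega>
    \<le> (1 - rho 1) ^ Suc k * (1 - post L rho N f0 f1 k 1 \<omega>)"
  proof -
    have "AE \<omega> in M. m \<le> k \<longrightarrow> pmf cp (simul m) * likr (simul m) k (obs k \<omega>) * post L rho N f0 f1 k 1 \<omega>
      \<le> (1 - rho 1) ^ Suc k * (1 - post L rho N f0 f1 k 1 \<omega>)" for m k
      using post_1_upper[where m=m and k=k] by (cases "m \<le> k") simp_all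
    then show ?thesis unfolding AE_all_countable by blast
  qed
  ultimately show ?thesis
  proof eventually_elim
    case (elim \<omega>)
    show ?case
    proof (intro allI impI)
      fix m k
      assume mk: "1 \<le> m" "m \<le> k" and pos: "\<forall>i\<in>{m..k}. \<forall>l\<in>{1..L}. 0 < lr (snd \<omega> (i, l))"
        and A: "A \<le> ln C0 + (\<Sum>i=m..k. step i (snd \<omega>))"
      let ?p = "post L rho N f0 f1 k 1 \<omega>"
      let ?S = "\<Sum>i=m..k. \<Sum>l=1..L. ln (lr (snd \<omega> (i, l)))"
      have p: "0 < ?p" using elim by blast
      have r: "0 < 1 - rho 1" using rho1 by simp
      have "(1 - rho 1) ^ m * (rho 1 * C0) * exp ?S * ?p \<le> pmf cp (simul m) * likr (simul m) k (obs k \<omega>) * ?p"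
      proof -
        have "(1 - rho 1) ^ m * (rho 1 * C0) \<le> pmf cp (simul m)"
          using pmf_cp_pmf_const_ge[OF L rho, where m=m] rho1 by (simp add: simul_def C0_def)
        then show ?thesis
          using likr_simul[OF mk] pos p by (intro mult_right_mono) auto
      qed
      also have "\<dots> \<le> (1 - rho 1) ^ Suc k * (1 - ?p)" using elim mk by blast
      \<comment> \<open>\<open>Suc k - m\<close> is the number of steps from \<open>m\<close> to
        \<open>k\<close>, so each step receives exactly one \<open>\<kappa>\<close>.\<close>
      also have "(1 - rho 1) ^ Suc k = (1 - rho 1) ^ m * exp (- (real (Suc k - m) * \<kappa>))"
      proof -
        have "exp (- (real (Suc k - m) * \<kappa>)) = (1 - rho 1) ^ (Suc k - m)"
          using r by (simp add: \<kappa>_def exp_of_nat_mult)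
        then show ?thesis using mk by (simp add: power_add[symmetric] del: power_Suc)
      qed
      finally have "(1 - rho 1) ^ m * (rho 1 * C0 * exp ?S * ?p) \<le> (1 - rho 1) ^ m * (exp (- (real (Suc k - m) * \<kappa>)) * (1 - ?p))"
        by (simp add: mult_ac)
      then have "rho 1 * C0 * exp ?S * ?p \<le> exp (- (real (Suc k - m) * \<kappa>)) * (1 - ?p)"
        using r by simp
      then have "C0 * (exp ?S * exp (real (Suc k - m) * \<kappa>)) \<le> (1 - ?p) / (rho 1 * ?p)"
        using p rho1 by (simp add: exp_minus field_simps)
      also have "\<dots> = Q k \<omega>" using Q_eq elim by simp
      also have "exp ?S * exp (real (Suc k - m) * \<kappa>) = exp (\<Sum>i=m..k. step i (snd \<omega>))"
        by (simp add: step_def sum.distrib exp_add)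
      finally have "C0 * exp (\<Sum>i=m..k. step i (snd \<omega>)) \<le> Q k \<omega>" .
      moreover have "0 < C0 * exp (\<Sum>i=m..k. step i (snd \<omega>))" using C0_pos by simp
      ultimately have "ln (C0 * exp (\<Sum>i=m..k. step i (snd \<omega>))) \<le> ln (Q k \<omega>)" by simp
      then have "A \<le> ln (Q k \<omega>)" using A C0_pos by (simp add: ln_mult)
      then show "\<nu> A \<omega> \<le> enat k" by (auto simp: nu_le_iff)
    qed
  qed
qed

text \<open>Here \<open>R\<close> need not be a measurable predicate: a measurable null set covering
  the exceptions is passed to the fibre instead.\<close>

lemma AE_M_fiber:
  assumes "AE \<omega> in M. R \<omega>" "g \<in> set_pmf cp"
  shows "AE z in P g. R (g, z)"
proof -
  obtain A where A: "\<And>\<omega>. \<omega> \<in> space M - A \<Longrightarrow> R \<omega>" "A \<in> null_sets M"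
    using AE_E3[OF assms(1)] by blast
  have "A \<in> sets M" using A(2) by auto
  then have [measurable]: "A \<in> sets (count_space UNIV \<Otimes>\<^sub>M PiM UNIV (\<lambda>_. N))" by simp
  have "AE \<omega> in M. \<omega> \<notin> A" using A(2) by (rule AE_not_in)
  then have "AE z in P g. (g, z) \<notin> A"
    using assms(2) by (subst (asm) AE_M) auto
  then show ?thesis using AE_space by eventually_elim (use A(1) in auto)
qed

lemma AE_lr_pos: "AE z in P g. \<forall>i l. g l \<le> i \<longrightarrow> 0 < lr (z (i, l))"
proof -
  have P1: "AE x in P1. 0 < lr x"
    using mutual_ac f0_nonneg f1_nonneg by (subst AE_density) (auto elim!: eventually_mono simp: lr_def)
  have "AE z in P g. g l \<le> i \<longrightarrow> 0 < lr (z (i, l))" for i l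
  proof (cases "g l \<le> i")
    case True
    then have "law g (i, l) = P1" by (simp add: law_def)
    then have "AE x in law g (i, l). 0 < lr x" using P1 by (simp only:)
    then have "AE z in P g. 0 < lr (z (i, l))"
      unfolding obs_meas_eq by (intro AE_PiM_component[OF prob_law]) auto
    then show ?thesis by simp
  qed simp
  then show ?thesis unfolding AE_all_countable by blast
qed

text \<open>Gibbs' inequality, from \<open>ln t \<le> t - 1\<close> at
  \<open>t = f0 x / f1 x\<close>. It gives \<open>rate_pos\<close>, and in the lower bound it allows
  the count of changed cells to be replaced by its maximum \<open>L * K\<close>.\<close>

lemma KL_nonneg: "0 \<le> D"
proof -
  have i0: "integrable N f0" and I0: "(\<integral>x. f0 x \<partial>N) = 1"
    using f0_dens f0_nonneg by (auto intro!: integrableI_nonneg simp: integral_eq_nn_integral)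
  have i1: "integrable N f1" and I1: "(\<integral>x. f1 x \<partial>N) = 1"
    using f1_dens f1_nonneg by (auto intro!: integrableI_nonneg simp: integral_eq_nn_integral)
  have "0 = (\<integral>x. f1 x - f0 x \<partial>N)" using i0 i1 I0 I1 by simp
  also have "\<dots> \<le> D"
    unfolding KL_def
  proof (intro integral_mono_AE D_finite Bochner_Integration.integrable_diff i0 i1)
    show "AE x in N. f1 x - f0 x \<le> f1 x * ln (f1 x / f0 x)"
      using mutual_ac AE_space
    proof eventually_elim
      case (elim x)
      show ?case
      proof (cases "0 < f1 x")
        case True
        then have 0: "0 < f0 x" using elim by simp
        have "ln (f0 x / f1 x) \<le> f0 x / f1 x - 1" using 0 True by (intro ln_le_minus_one) simp
        moreover have "ln (f1 x / f0 x) = - ln (f0 x / f1 x)" using 0 True by (simp add: ln_div)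
        ultimately have "f1 x * (1 - f0 x / f1 x) \<le> f1 x * ln (f1 x / f0 x)"
          using True by (intro mult_left_mono) auto
        moreover have "f1 x * (1 - f0 x / f1 x) = f1 x - f0 x" using True by (simp add: field_simps)
        ultimately show ?thesis by simp
      next
        case False
        then show ?thesis using elim f0_nonneg f1_nonneg[of x] by auto
      qed
    qed
  qed
  finally show ?thesis .
qed

lemma integrable_ln_lr: "integrable P1 (\<lambda>x. ln (lr x))" and integral_ln_lr: "(\<integral>x. ln (lr x) \<partial>P1) = D"
proof -
  have nn: "AE x in N. 0 \<le> f1 x" using f1_nonneg by (rule AE_I2)
  have "integrable N (\<lambda>x. f1 x *\<^sub>R ln (lr x))" using D_finite by (simp add: lr_def)
  then show "integrable P1 (\<lambda>x. ln (lr x))" using nn by (subst integrable_density) auto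
  show "(\<integral>x. ln (lr x) \<partial>P1) = D" using nn by (subst integral_density) (auto simp: lr_def KL_def)
qed


section \<open>The truncated walk and its expected crossing time\<close>

definition rate :: real where "rate = real L * D + \<kappa>"

text \<open>Cut from above only: the overshoot needs just an upper bound on the steps, and since the
  truncated walk lies below the full one, its crossing still forces the test to stop.\<close>

definition D_trunc :: "real \<Rightarrow> real" where "D_trunc B = (\<integral>x. min (ln (lr x)) B \<partial>P1)"

definition step_trunc :: "real \<Rightarrow> nat \<Rightarrow> (nat \<times> nat \<Rightarrow> 'a) \<Rightarrow> real" where
  "step_trunc B i z = (\<Sum>l=1..L. min (ln (lr (z (i, l)))) B) + \<kappa>"

lemma rate_pos: "0 < rate"
  using KL_nonneg kappa_pos by (simp add: rate_def add_nonneg_pos)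

lemma step_trunc_le: "step_trunc B i z \<le> step i z"
  unfolding step_trunc_def step_def by (intro add_right_mono sum_mono) auto

lemma step_trunc_le_bound: "step_trunc B i z \<le> real L * B + \<kappa>"
  unfolding step_trunc_def using sum_bounded_above[of "{1..L}" "\<lambda>l. min (ln (lr (z (i, l)))) B" B] by simp

lemma integrable_trunc: "integrable P1 (\<lambda>x. min (ln (lr x)) B)"
proof -
  interpret prob_space P1 by (rule prob_P1)
  show ?thesis using integrable_ln_lr by (intro integrable_min) auto
qed

lemma D_trunc_tendsto: "(\<lambda>B. D_trunc (real B)) \<longlonglongrightarrow> D"
  unfolding D_trunc_def integral_ln_lr[symmetric]
proof (rule integral_dominated_convergence[OF _ _ integrable_abs[OF integrable_ln_lr]])
  show "AE x in P1. (\<lambda>B. min (ln (lr x)) (real B)) \<longlonglongrightarrow> ln (lr x)"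
  proof (rule AE_I2)
    fix x
    have "eventually (\<lambda>B. ln (lr x) \<le> real B) sequentially"
      by (rule eventually_sequentiallyI[of "nat \<lceil>\<bar>ln (lr x)\<bar>\<rceil>"]) linarith
    then have "eventually (\<lambda>B. min (ln (lr x)) (real B) = ln (lr x)) sequentially"
      by eventually_elim auto
    then show "(\<lambda>B. min (ln (lr x)) (real B)) \<longlonglongrightarrow> ln (lr x)" by (rule tendsto_eventually)
  qed
  show "AE x in P1. norm (min (ln (lr x)) (real B)) \<le> \<bar>ln (lr x)\<bar>" for B by (auto simp: min_def)
qed auto

lemma component_changed:
  assumes "g (snd i) \<le> fst i" and [measurable]: "h \<in> borel_measurable N"
  shows "distr (P g) borel (\<lambda>z. h (z i) :: real) = distr P1 borel h"
    and "integrable P1 h \<Longrightarrow> integrable (P g) (\<lambda>z. h (z i))"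
    and "integrable P1 h \<Longrightarrow> (\<integral>z. h (z i) \<partial>P g) = (\<integral>x. h x \<partial>P1)"
proof -
  have "distr (P g) (law g i) (\<lambda>z. z i) = law g i"
    unfolding obs_meas_eq by (rule distr_PiM_component) (auto intro: prob_law)
  moreover have "law g i = P1" using assms by (simp add: law_def)
  ultimately have P1: "P1 = distr (P g) P1 (\<lambda>z. z i)" by simp
  have [measurable]: "(\<lambda>z. z i) \<in> measurable (P g) P1" by measurable
  show "distr (P g) borel (\<lambda>z. h (z i)) = distr P1 borel h"
    by (subst P1, subst distr_distr) (auto simp: o_def)
  show "integrable (P g) (\<lambda>z. h (z i))" if "integrable P1 h"
    using that by (subst (asm) P1, subst (asm) integrable_distr_eq) auto
  show "(\<integral>z. h (z i) \<partial>P g) = (\<integral>x. h x \<partial>P1)"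
    by (subst P1, subst integral_distr) auto
qed

lemma indep_coordinates: "prob_space.indep_vars (P g) (law g) (\<lambda>i z. z i) UNIV"
proof -
  interpret PP: product_prob_space "law g" UNIV by (rule product_prob_law)
  show ?thesis unfolding obs_meas_eq by (rule PP.indep_vars_component) simp
qed

text \<open>Different steps read disjoint rows of independent cells.\<close>

lemma indep_step_trunc: "prob_space.indep_vars (P g) (\<lambda>_. borel) (\<lambda>t z. step_trunc B (m + t) z) UNIV"
proof -
  interpret prob_space "P g" by (rule prob_P)
  let ?K = "\<lambda>t. {m + t} \<times> {1..L}"
  have "indep_vars (\<lambda>t. PiM (?K t) (law g)) (\<lambda>t z. restrict (\<lambda>i. z i) (?K t)) UNIV"
    by (rule indep_vars_restrict[OF indep_coordinates]) (auto simp: disjoint_family_on_def)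
  then have "indep_vars (\<lambda>_. borel) (\<lambda>t z. step_trunc B (m + t) (restrict (\<lambda>i. z i) (?K t))) UNIV"
  proof (rule indep_vars_compose2)
    fix t
    have "(\<lambda>y. y (m + t, l)) \<in> measurable (PiM (?K t) (law g)) N" if "l \<in> {1..L}" for l
      using measurable_component_singleton[of "(m + t, l)" "?K t" "law g"] that by simp
    then show "step_trunc B (m + t) \<in> borel_measurable (PiM (?K t) (law g))"
      unfolding step_trunc_def
      by (intro borel_measurable_add borel_measurable_sum borel_measurable_min borel_measurable_const
          borel_measurable_ln measurable_compose[OF _ lr_measurable]) auto
  qed
  also have "(\<lambda>t z. step_trunc B (m + t) (restrict (\<lambda>i. z i) (?K t))) = (\<lambda>t z. step_trunc B (m + t) z)"
    unfolding step_trunc_def by (intro ext arg_cong2[where f="(+)"] sum.cong refl) auto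
  finally show ?thesis .
qed

text \<open>Given the change-points, survival beyond \<open>m + i\<close> means that the truncated
  walk started at \<open>m\<close> has not reached \<open>A - ln C0\<close> within \<open>i\<close>
  steps. The three summands are the waiting time, the rounding from the maximum with 1, and the
  bound from Wald's identity.\<close>

lemma nn_integral_nu_fiber:
  assumes g: "g \<in> set_pmf cp" and A: "0 \<le> A" and B: "0 \<le> B" and c: "0 < real L * D_trunc B + \<kappa>"
  shows "(\<integral>\<^sup>+ z. ennreal_of_enat (\<nu> A (g, z)) \<partial>P g)
    \<le> of_nat (g L) + 1 + ennreal ((A - ln C0 + (real L * B + \<kappa>)) / (real L * D_trunc B + \<kappa>))"
proof -
  interpret prob_space "P g" by (rule prob_P)
  \<comment> \<open>Change-points may be 0, but the first observation is at time 1.\<close>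
  define m where "m = max (g L) 1"
  define b where "b = A - ln C0"
  have b: "0 \<le> b" using A ln_C0_le by (simp add: b_def)
  define X where "X t z = step_trunc B (m + t) z" for t z
  have changed: "g l \<le> m + t" if "l \<in> {1..L}" for l t
    using cp_pmf_mono[OF g, of l L] that by (auto simp: m_def)
  define E where "E n = {z\<in>space (P g). \<forall>j\<in>{1..n}. (\<Sum>t<j. X t z) < b}" for n
  have int: "integrable (P g) (X t)" and ex: "expectation (X t) = real L * D_trunc B + \<kappa>" for t
  proof -
    have 1: "integrable (P g) (\<lambda>z. min (ln (lr (z (m + t, l)))) B)"
      and 2: "expectation (\<lambda>z. min (ln (lr (z (m + t, l)))) B) = D_trunc B" if "l \<in> {1..L}" for l
      using component_changed(2,3)[of g "(m + t, l)" "\<lambda>x. min (ln (lr x)) B"] changed[OF that, of t] integrable_trunc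
      by (auto simp: D_trunc_def)
    have 3: "integrable (P g) (\<lambda>z. \<Sum>l=1..L. min (ln (lr (z (m + t, l)))) B)"
      by (intro Bochner_Integration.integrable_sum 1)
    then show "integrable (P g) (X t)"
      unfolding X_def step_trunc_def by (intro Bochner_Integration.integrable_add) auto
    have "expectation (X t) = expectation (\<lambda>z. \<Sum>l=1..L. min (ln (lr (z (m + t, l)))) B) + \<kappa>"
      unfolding X_def step_trunc_def by (subst Bochner_Integration.integral_add[OF 3]) (auto simp: prob_space[unfolded space_P])
    also have "expectation (\<lambda>z. \<Sum>l=1..L. min (ln (lr (z (m + t, l)))) B) = (\<Sum>l=1..L. D_trunc B)"
      by (subst Bochner_Integration.integral_sum) (auto intro!: 1 sum.cong simp: 2)
    finally show "expectation (X t) = real L * D_trunc B + \<kappa>" by simp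
  qed
  have [measurable]: "X t \<in> borel_measurable (P g)" for t using int by auto
  have E_sets [measurable]: "E n \<in> sets (P g)" for n unfolding E_def by measurable
  have sum_E: "(\<Sum>i<n. prob (E i)) \<le> (b + (real L * B + \<kappa>)) / (real L * D_trunc B + \<kappa>)" for n
    unfolding E_def
  proof (rule sum_prob_no_crossing_le)
    show "indep_vars (\<lambda>_. borel) X UNIV" unfolding X_def by (rule indep_step_trunc)
    show "0 \<le> real L * B + \<kappa>" using B kappa_pos by simp
    show "X i z \<le> real L * B + \<kappa>" for i z unfolding X_def by (rule step_trunc_le_bound)
  qed (use int ex c b in auto)
  have "AE z in P g. \<forall>i. enat (m + i) < \<nu> A (g, z) \<longrightarrow> z \<in> E i"
    using AE_M_fiber[OF nu_le_if_walk_crosses g, of A] AE_lr_pos[of g] AE_space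
  proof eventually_elim
    case (elim z)
    show ?case
    proof (intro allI impI)
      fix i assume i: "enat (m + i) < \<nu> A (g, z)"
      have "(\<Sum>t<j. X t z) < b" if j: "j \<in> {1..i}" for j
      proof (rule ccontr)
        assume n: "\<not> (\<Sum>t<j. X t z) < b"
        \<comment> \<open>\<open>j\<close> steps starting at \<open>m\<close> end at
          \<open>m + j - 1\<close>, which does not exceed \<open>m + i\<close>.\<close>
        define k where "k = m + j - 1"
        have k: "1 \<le> m" "m \<le> k" using j by (auto simp: k_def m_def)
        have "(\<Sum>t<j. X t z) \<le> (\<Sum>t<j. step (m + t) z)"
          unfolding X_def by (intro sum_mono step_trunc_le)
        also have "\<dots> = (\<Sum>i=m..k. step i z)"
          by (rule sum.reindex_bij_witness[of _ "\<lambda>i. i - m" "\<lambda>t. m + t"]) (use j in \<open>auto simp: k_def\<close>)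
        finally have "A \<le> ln C0 + (\<Sum>i=m..k. step i z)" using n by (simp add: b_def)
        moreover have "\<forall>i\<in>{m..k}. \<forall>l\<in>{1..L}. 0 < lr (z (i, l))"
        proof (intro ballI)
          fix i l assume "i \<in> {m..k}" "l \<in> {1..L}"
          then have "g l \<le> i" using changed[of l "i - m"] by auto
          then show "0 < lr (z (i, l))" using elim by blast
        qed
        ultimately have "\<nu> A (g, z) \<le> enat k" using elim k by simp
        also have "enat k \<le> enat (m + i)" using j by (auto simp: k_def)
        finally show False using i by simp
      qed
      then show "z \<in> E i" using elim by (simp add: E_def)
    qed
  qed
  then have "AE z in P g. ennreal_of_enat (\<nu> A (g, z)) \<le> of_nat m + (\<Sum>i. indicator (E i) z)"
  proof eventually_elim
    case (elim z)
    have "ennreal_of_enat (\<nu> A (g, z)) \<le> of_nat m + (\<Sum>i. indicator {i. enat (m + i) < \<nu> A (g, z)} i)"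
      by (rule ennreal_of_enat_le_suminf)
    also have "\<dots> \<le> of_nat m + (\<Sum>i. indicator (E i) z)"
      using elim by (intro add_left_mono suminf_le) (auto simp: indicator_def)
    finally show ?case .
  qed
  then have "(\<integral>\<^sup>+ z. ennreal_of_enat (\<nu> A (g, z)) \<partial>P g) \<le> (\<integral>\<^sup>+ z. of_nat m + (\<Sum>i. indicator (E i) z) \<partial>P g)"
    by (rule nn_integral_mono_AE)
  also have "\<dots> = of_nat m + (\<Sum>i. emeasure (P g) (E i))"
    by (simp add: nn_integral_add nn_integral_suminf emeasure_space_1[unfolded space_P] nn_integral_indicator[OF E_sets])
  also have "(\<Sum>i. emeasure (P g) (E i)) \<le> ennreal ((b + (real L * B + \<kappa>)) / (real L * D_trunc B + \<kappa>))"
    unfolding suminf_eq_SUP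
  proof (rule SUP_least)
    fix n
    have "(\<Sum>i<n. emeasure (P g) (E i)) = ennreal (\<Sum>i<n. prob (E i))"
      by (simp add: emeasure_eq_measure sum_ennreal)
    then show "(\<Sum>i<n. emeasure (P g) (E i)) \<le> ennreal ((b + (real L * B + \<kappa>)) / (real L * D_trunc B + \<kappa>))"
      using sum_E by (simp add: ennreal_leI)
  qed
  also have "of_nat m \<le> (of_nat (g L) + 1 :: ennreal)"
  proof -
    have "m \<le> g L + 1" by (simp add: m_def)
    then have "(of_nat m :: ennreal) \<le> of_nat (g L + 1)" by (subst of_nat_le_iff)
    then show ?thesis by (simp add: add.commute)
  qed
  finally show ?thesis by (simp add: b_def add_right_mono)
qed

text \<open>The truncation point \<open>B\<close> is chosen once, from \<open>c'\<close> alone, so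
  that the truncated drift exceeds \<open>c'\<close>. The mean of \<Gamma>_L, the overshoot and
  \<open>ln C0\<close> then form a constant that does not depend on the level.\<close>

lemma nn_integral_nu_le:
  assumes c': "0 < c'" "c' < rate"
  shows "\<exists>K\<ge>0. \<forall>A\<ge>0. (\<integral>\<^sup>+ \<omega>. ennreal_of_enat (\<nu> A \<omega>) \<partial>M) \<le> ennreal (K + A / c')"
proof -
  have "(\<lambda>B. real L * D_trunc (real B) + \<kappa>) \<longlonglongrightarrow> rate"
    unfolding rate_def by (intro tendsto_intros D_trunc_tendsto)
  then have "eventually (\<lambda>B. c' < real L * D_trunc (real B) + \<kappa>) sequentially"
    using c' by (intro order_tendstoD(1))
  then obtain B :: nat where cB: "c' < real L * D_trunc (real B) + \<kappa>"
    by (auto simp: eventually_sequentially)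
  define cB where "cB = real L * D_trunc (real B) + \<kappa>"
  define e where "e = - ln C0 + (real L * real B + \<kappa>)"
  have e: "0 \<le> e" using ln_C0_le kappa_pos by (simp add: e_def add_increasing)
  define G where "G = (\<integral>\<^sup>+ g. of_nat (g L) \<partial>cp :: ennreal)"
  have G: "G < \<infinity>" unfolding G_def using nn_integral_cp_pmf_finite rho by auto
  define K where "K = enn2real G + 1 + e / cB"
  have cB0: "0 < cB" using cB c' by (simp add: cB_def)
  have "(\<integral>\<^sup>+ \<omega>. ennreal_of_enat (\<nu> A \<omega>) \<partial>M) \<le> ennreal (K + A / c')" if A: "0 \<le> A" for A
  proof -
    have "(\<lambda>\<omega>. ennreal_of_enat (\<nu> A \<omega>)) \<in> borel_measurable M"
      by (rule borel_measurable_ennreal_of_enat) (rule stopping_time_sets[OF obs_stopping_time_nu])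
    then have "(\<lambda>\<omega>. ennreal_of_enat (\<nu> A \<omega>)) \<in> borel_measurable (count_space UNIV \<Otimes>\<^sub>M PiM UNIV (\<lambda>_. N))"
      by (simp cong: measurable_cong_sets)
    then have "(\<integral>\<^sup>+ \<omega>. ennreal_of_enat (\<nu> A \<omega>) \<partial>M) = (\<integral>\<^sup>+ g. (\<integral>\<^sup>+ z. ennreal_of_enat (\<nu> A (g, z)) \<partial>P g) \<partial>cp)"
      by (rule nn_integral_M)
    also have "\<dots> \<le> (\<integral>\<^sup>+ g. of_nat (g L) + (1 + ennreal ((A + e) / cB)) \<partial>cp)"
    proof (intro nn_integral_mono_AE, unfold AE_measure_pmf_iff, intro ballI)
      fix g assume g: "g \<in> set_pmf cp"
      have eq: "A - ln C0 + (real L * real B + \<kappa>) = A + e" by (simp add: e_def)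
      show "(\<integral>\<^sup>+ z. ennreal_of_enat (\<nu> A (g, z)) \<partial>P g) \<le> of_nat (g L) + (1 + ennreal ((A + e) / cB))"
        using nn_integral_nu_fiber[OF g A, of "real B"] cB0
        unfolding eq cB_def[symmetric] by (simp add: add.assoc)
    qed
    also have "\<dots> = G + (1 + ennreal ((A + e) / cB))"
      by (subst nn_integral_add) (auto simp: G_def)
    also have "\<dots> = ennreal (enn2real G + (1 + (A + e) / cB))"
    proof -
      have "0 \<le> (A + e) / cB" using A e cB0 by simp
      then have "ennreal (enn2real G + (1 + (A + e) / cB)) = ennreal (enn2real G) + (ennreal 1 + ennreal ((A + e) / cB))"
        by (subst ennreal_plus, simp, simp, subst ennreal_plus, simp_all)
      then show ?thesis using G by simp
    qed
    also have "\<dots> \<le> ennreal (K + A / c')"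
    proof (rule ennreal_leI)
      have "A / cB \<le> A / c'" using A c' cB cB0 by (intro divide_left_mono) (auto simp: cB_def)
      then show "enn2real G + (1 + (A + e) / cB) \<le> K + A / c'" by (simp add: K_def add_divide_distrib)
    qed
    finally show ?thesis .
  qed
  moreover have "0 \<le> K" using e cB0 by (simp add: K_def)
  ultimately show ?thesis by blast
qed


section \<open>False-alarm probability of the test \<open>nu\<close>\<close>

lemma post_1_le:
  assumes \<alpha>: "0 < \<alpha>" "\<alpha> < 1"
  shows "AE \<omega> in M. ln (1 / (rho 1 * \<alpha>)) \<le> ln (Q k \<omega>) \<longrightarrow> post L rho N f0 f1 k 1 \<omega> \<le> \<alpha>"
  \<comment> \<open>The instance \<open>m = 0\<close> serves only to show that this version of the
    posterior is at most 1: its left side is nonnegative.\<close>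
  using post_sum[of k] post_1_pos[of k] post_1_upper[where m=0 and k=k, OF le0] AE_space
proof (eventually_elim, intro impI)
  fix \<omega>
  let ?p = "post L rho N f0 f1 k 1 \<omega>"
  assume sum: "(\<Sum>l=2..L+1. post L rho N f0 f1 k l \<omega>) = 1 - ?p" and p: "0 < ?p"
    and up: "pmf cp (simul 0) * likr (simul 0) k (obs k \<omega>) * ?p \<le> (1 - rho 1) ^ Suc k * (1 - ?p)"
    and \<omega>: "\<omega> \<in> space M" and le: "ln (1 / (rho 1 * \<alpha>)) \<le> ln (Q k \<omega>)"
  have "0 \<le> pmf cp (simul 0) * likr (simul 0) k (obs k \<omega>) * ?p"
    using likr_nonneg[OF obs_in_space[OF \<omega>]] p by simp
  then have "0 \<le> (1 - rho 1) ^ Suc k * (1 - ?p)" using up by linarith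
  moreover have "0 < (1 - rho 1) ^ Suc k" using rho1 by (intro zero_less_power) simp
  ultimately have "0 \<le> 1 - ?p"
    using mult_left_le_imp_le[of "(1 - rho 1) ^ Suc k" 0 "1 - ?p"] by simp
  then have p1: "?p \<le> 1" by simp
  have Q: "Q k \<omega> = (1 - ?p) / (rho 1 * ?p)" by (rule Q_eq[OF sum])
  have r\<alpha>: "0 < rho 1 * \<alpha>" "rho 1 * \<alpha> < 1"
    using rho1 \<alpha> mult_strict_mono[of "rho 1" 1 \<alpha> 1] by auto
  then have "0 < ln (1 / (rho 1 * \<alpha>))" by (intro ln_gt_zero) simp
  \<comment> \<open>Since \<open>ln 0 = 0\<close> in HOL, a vanishing \<open>Q\<close> must be
    excluded before the logarithms are compared; the level is positive, so it cannot have been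
    reached there.\<close>
  then have "Q k \<omega> \<noteq> 0"
  proof (intro notI)
    assume "0 < ln (1 / (rho 1 * \<alpha>))" "Q k \<omega> = 0"
    then show False using le by (simp only: ln_0)
  qed
  moreover have "0 \<le> Q k \<omega>" unfolding Q using p p1 rho1 by simp
  ultimately have Q0: "0 < Q k \<omega>" by (metis order_le_less)
  then have "1 / (rho 1 * \<alpha>) \<le> (1 - ?p) / (rho 1 * ?p)"
    using le r\<alpha> Q0 unfolding Q by simp
  then have "?p \<le> \<alpha> * (1 - ?p)" using p rho1 \<alpha> by (simp add: field_simps)
  also have "\<dots> \<le> \<alpha>" using p \<alpha> by (simp add: mult_left_le)
  finally show "?p \<le> \<alpha>" .
qed

lemma AE_cp_event_1: "AE \<omega> in M. \<omega> \<in> cp_event L k 1 \<longleftrightarrow> k < fst \<omega> 1"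
  using AE_fst_M
proof eventually_elim
  case (elim \<omega>)
  have "k < fst \<omega> i" if "k < fst \<omega> 1" "i \<in> {1..L}" for i
    using cp_pmf_mono[OF elim, of 1 i] that by auto
  then show ?case using L by (auto simp: cp_event_def)
qed

lemma sets_M_fst [measurable]: "{\<omega>\<in>space M. R (fst \<omega>)} \<in> sets M"
proof -
  have "Measurable.pred M (\<lambda>\<omega>. R (fst \<omega>))"
    by (rule measurable_compose[OF fst_M_measurable]) simp
  then show ?thesis by measurable
qed

text \<open>Split by the value of the stopping time. The event of stopping at \<open>k\<close> is
  known at time \<open>k\<close>, and on it the posterior probability of "no change" is at most
  \<open>\<alpha>\<close>, so false alarms take at most the fraction \<open>\<alpha>\<close> of each
  piece.\<close>

lemma nu_in_Delta:
  assumes \<alpha>: "0 < \<alpha>" "\<alpha> < 1"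
  shows "\<nu> (ln (1 / (rho 1 * \<alpha>))) \<in> Delta L rho N f0 f1 \<alpha>"
proof -
  interpret prob_space M by (rule prob_M)
  define A where "A = ln (1 / (rho 1 * \<alpha>))"
  define S where "S k = {\<omega>\<in>space M. \<nu> A \<omega> = enat k}" for k
  have SF: "S k \<in> sets (F k)" for k
  proof -
    have "{\<omega>\<in>space M. \<nu> A \<omega> \<le> enat j} \<in> sets (F k)" if "j \<le> k" for j
      using stopping_time_sets(1)[OF obs_stopping_time_nu] F_mono[OF that] by blast
    then have "{\<omega>\<in>space M. \<nu> A \<omega> \<le> enat k} - (\<Union>j\<in>{..<k}. {\<omega>\<in>space M. \<nu> A \<omega> \<le> enat j}) \<in> sets (F k)"
      by (intro sets.Diff sets.finite_UN) (simp_all only: finite_lessThan lessThan_iff less_imp_le order_refl)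
    also have "{\<omega>\<in>space M. \<nu> A \<omega> \<le> enat k} - (\<Union>j\<in>{..<k}. {\<omega>\<in>space M. \<nu> A \<omega> \<le> enat j}) = S k"
    proof -
      have "x \<le> enat k \<and> (\<forall>j<k. \<not> x \<le> enat j) \<longleftrightarrow> x = enat k" for x
        by (cases x) (auto simp: not_le intro: antisym leI)
      then show ?thesis unfolding S_def by blast
    qed
    finally show ?thesis .
  qed
  have SM [measurable]: "S k \<in> sets M" for k
    using SF subalgebra_F by (auto simp: subalgebra_def)
  have piece: "emeasure M (S k \<inter> {\<omega>\<in>space M. k < fst \<omega> 1}) \<le> ennreal \<alpha> * emeasure M (S k)" for k
  proof -
    interpret sigma_finite_subalgebra M "F k" by (rule sigma_finite_F)
    have i1: "integrable M (\<lambda>\<omega>. indicator (S k) \<omega> * indicator (cp_event L k 1) \<omega> :: real)"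
      using integrable_mult_indicator[OF SM integrable_cp_event] by simp
    have i2: "integrable M (\<lambda>\<omega>. indicator (S k) \<omega> * post L rho N f0 f1 k 1 \<omega>)"
    proof -
      have "integrable M (post L rho N f0 f1 k 1)"
        unfolding post_def by (rule real_cond_exp_int(1)[OF integrable_cp_event])
      from integrable_mult_indicator[OF SM this] show ?thesis by simp
    qed
    have "emeasure M (S k \<inter> {\<omega>\<in>space M. k < fst \<omega> 1}) = (\<integral>\<^sup>+ \<omega>. indicator (S k \<inter> {\<omega>\<in>space M. k < fst \<omega> 1}) \<omega> \<partial>M)"
      by (rule nn_integral_indicator[symmetric]) (intro sets.Int SM sets_M_fst)
    also have "\<dots> = (\<integral>\<^sup>+ \<omega>. ennreal (indicator (S k) \<omega> * indicator (cp_event L k 1) \<omega>) \<partial>M)"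
    proof (rule nn_integral_cong_AE)
      show "AE \<omega> in M. indicator (S k \<inter> {\<omega>\<in>space M. k < fst \<omega> 1}) \<omega> = ennreal (indicator (S k) \<omega> * indicator (cp_event L k 1) \<omega>)"
        using AE_cp_event_1[of k] AE_space by eventually_elim (auto simp: indicator_def)
    qed
    also have "\<dots> = ennreal (\<integral>\<omega>. indicator (S k) \<omega> * indicator (cp_event L k 1) \<omega> \<partial>M)"
      by (intro nn_integral_eq_integral i1) auto
    also have "(\<integral>\<omega>. indicator (S k) \<omega> * indicator (cp_event L k 1) \<omega> \<partial>M) = (\<integral>\<omega>. indicator (S k) \<omega> * post L rho N f0 f1 k 1 \<omega> \<partial>M)"
      using real_cond_exp_intA[OF integrable_cp_event SF, of k 1] by (simp add: post_def set_lebesgue_integral_def)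
    also have "\<dots> \<le> (\<integral>\<omega>. \<alpha> * indicator (S k) \<omega> \<partial>M)"
    proof (intro integral_mono_AE i2)
      show "AE \<omega> in M. indicator (S k) \<omega> * post L rho N f0 f1 k 1 \<omega> \<le> \<alpha> * indicator (S k) \<omega>"
        using post_1_le[OF \<alpha>, of k]
      proof eventually_elim
        case (elim \<omega>)
        have "ln (1 / (rho 1 * \<alpha>)) \<le> ln (Q k \<omega>)" if "\<omega> \<in> S k"
        proof -
          have 1: "\<nu> A \<omega> = enat k" using that by (simp add: S_def)
          then obtain j where j: "j \<le> k" "A \<le> ln (Q j \<omega>)" using nu_le_iff[of A \<omega> k] by auto
          then have "\<nu> A \<omega> \<le> enat j" by (auto simp: nu_le_iff)
          then show ?thesis using 1 j by (simp add: A_def)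
        qed
        then show ?case using elim by (auto simp: indicator_def)
      qed
      show "integrable M (\<lambda>\<omega>. \<alpha> * indicator (S k) \<omega>)"
        by (intro integrable_mult_right integrable_real_indicator SM) (simp add: emeasure_eq_measure)
    qed
    also have "\<dots> = \<alpha> * prob (S k)" using sets.sets_into_space[OF SM[of k]]
      by (simp add: Int_absorb2 del: space_M)
    finally show ?thesis using \<alpha> by (simp add: emeasure_eq_measure ennreal_mult ennreal_leI)
  qed
  \<comment> \<open>The value infinity contributes nothing, because \<Gamma>_1 is finite.\<close>
  have "{\<omega>\<in>space M. \<nu> A \<omega> < enat (fst \<omega> 1)} = (\<Union>k. S k \<inter> {\<omega>\<in>space M. k < fst \<omega> 1})"
  proof -
    have "x < enat n \<longleftrightarrow> (\<exists>k. x = enat k \<and> k < n)" for x n by (cases x) auto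
    then show ?thesis unfolding S_def by blast
  qed
  moreover have "range (\<lambda>k. S k \<inter> {\<omega>\<in>space M. k < fst \<omega> 1}) \<subseteq> sets M"
    by (intro image_subsetI sets.Int SM sets_M_fst)
  ultimately have "emeasure M {\<omega>\<in>space M. \<nu> A \<omega> < enat (fst \<omega> 1)} \<le> (\<Sum>k. emeasure M (S k \<inter> {\<omega>\<in>space M. k < fst \<omega> 1}))"
    using emeasure_subadditive_countably by (simp only:)
  also have "\<dots> \<le> (\<Sum>k. ennreal \<alpha> * emeasure M (S k))"
    using piece by (intro suminf_le) auto
  also have "\<dots> = ennreal \<alpha> * emeasure M (\<Union>k. S k)"
  proof -
    have "range S \<subseteq> sets M" by (intro image_subsetI SM)
    moreover have "disjoint_family S" by (auto simp: disjoint_family_on_def S_def)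
    ultimately show ?thesis by (simp only: ennreal_suminf_cmult suminf_emeasure)
  qed
  also have "\<dots> \<le> ennreal \<alpha>"
    using mult_left_mono[OF emeasure_le_1, of "ennreal \<alpha>"] by simp
  finally have "measure M {\<omega>\<in>space M. \<nu> A \<omega> < enat (fst \<omega> 1)} \<le> \<alpha>"
    using \<alpha> by (simp add: emeasure_eq_measure)
  then show ?thesis
    using obs_stopping_time_nu by (simp add: Delta_def A_def)
qed

section \<open>Lower bound for the detection delay\<close>

text \<open>Stopping by \<open>k\<close> while no change has occurred by \<open>k\<close> is a false
  alarm. Given no change the data follow \<open>Pinf k\<close>, so dividing by the probability
  \<open>(1 - rho 1) ^ Suc k\<close> of that event gives the bound.\<close>

lemma Pinf_early_stop:
  assumes \<tau>: "\<tau> \<in> Delta L rho N f0 f1 \<alpha>" and B [measurable]: "B \<in> sets (PiM (J k) (\<lambda>_. N))"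
    and eq: "{\<omega>\<in>space M. \<tau> \<omega> \<le> enat k} = {\<omega>\<in>space M. obs k \<omega> \<in> B}"
  shows "emeasure (Pinf k) B \<le> ennreal (exp (real (Suc k) * \<kappa>) * \<alpha>)"
proof -
  interpret prob_space M by (rule prob_M)
  note st = stopping_time_sets
  have stop: "obs_stopping_time L rho N f0 f1 \<tau>" and \<alpha>: "measure M {\<omega>\<in>space M. \<tau> \<omega> < enat (fst \<omega> 1)} \<le> \<alpha>"
    using \<tau> by (auto simp: Delta_def)
  have sets: "{\<omega>\<in>space M. \<tau> \<omega> < enat (fst \<omega> 1)} \<in> sets M"
  proof -
    have "{\<omega>\<in>space M. \<tau> \<omega> < enat (fst \<omega> 1)} = (\<Union>j. {\<omega>\<in>space M. \<tau> \<omega> \<le> enat j} \<inter> {\<omega>\<in>space M. j < fst \<omega> 1})"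
    proof -
      have "x < enat n \<longleftrightarrow> (\<exists>k. x \<le> enat k \<and> k < n)" for x n by (cases x) auto
      then show ?thesis by blast
    qed
    then show ?thesis using st(2)[OF stop] sets_M_fst by (auto intro!: sets.countable_UN sets.Int)
  qed
  have q: "0 < 1 - rho 1" using rho1 by simp
  have "ennreal ((1 - rho 1) ^ Suc k) * emeasure (Pinf k) B = (\<integral>\<^sup>+ \<omega>. indicator (cp_event L k 1) \<omega> * indicator B (obs k \<omega>) \<partial>M)"
    using nn_integral_no_change[of "indicator B" k] by simp
  also have "\<dots> \<le> (\<integral>\<^sup>+ \<omega>. indicator {\<omega>\<in>space M. \<tau> \<omega> < enat (fst \<omega> 1)} \<omega> \<partial>M)"
  proof (intro nn_integral_mono)
    fix \<omega> assume \<omega>: "\<omega> \<in> space M"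
    have "\<tau> \<omega> < enat (fst \<omega> 1)" if "\<omega> \<in> cp_event L k 1" "obs k \<omega> \<in> B"
    proof -
      have "\<tau> \<omega> \<le> enat k" using eq that \<omega> by blast
      also have "enat k < enat (fst \<omega> 1)" using that L by (simp add: cp_event_def)
      finally show ?thesis .
    qed
    then show "(indicator (cp_event L k 1) \<omega> * indicator B (obs k \<omega>) :: ennreal) \<le> indicator {\<omega>\<in>space M. \<tau> \<omega> < enat (fst \<omega> 1)} \<omega>"
      using \<omega> by (auto simp: indicator_def)
  qed
  also have "\<dots> = ennreal (measure M {\<omega>\<in>space M. \<tau> \<omega> < enat (fst \<omega> 1)})"
    using sets by (simp add: emeasure_eq_measure)
  also have "\<dots> \<le> ennreal \<alpha>" using \<alpha> by (rule ennreal_leI)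
  finally have 1: "ennreal ((1 - rho 1) ^ Suc k) * emeasure (Pinf k) B \<le> ennreal \<alpha>" .
  have e: "exp (real (Suc k) * \<kappa>) * (1 - rho 1) ^ Suc k = 1"
  proof -
    have "exp (real (Suc k) * \<kappa>) = (inverse (1 - rho 1)) ^ Suc k"
      using q unfolding exp_of_nat_mult \<kappa>_def by (simp add: exp_minus)
    then show ?thesis using q by (simp add: power_mult_distrib[symmetric] del: power_Suc)
  qed
  have "emeasure (Pinf k) B = ennreal (exp (real (Suc k) * \<kappa>)) * (ennreal ((1 - rho 1) ^ Suc k) * emeasure (Pinf k) B)"
  proof -
    have "ennreal (exp (real (Suc k) * \<kappa>)) * ennreal ((1 - rho 1) ^ Suc k) = 1"
      by (subst ennreal_mult'[symmetric]) (simp_all only: e exp_ge_zero ennreal_1)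
    then show ?thesis by (simp only: mult.assoc[symmetric] mult_1)
  qed
  also have "\<dots> \<le> ennreal (exp (real (Suc k) * \<kappa>)) * ennreal \<alpha>"
    using 1 by (intro mult_left_mono) auto
  also have "\<dots> = ennreal (exp (real (Suc k) * \<kappa>) * \<alpha>)" by (simp add: ennreal_mult'[symmetric])
  finally show ?thesis .
qed

text \<open>Split the data at likelihood level \<open>c\<close>: below it the density is at most
  \<open>c\<close>; above it \<open>B\<close> is dropped and the true law is kept.\<close>

lemma change_of_measure:
  assumes B [measurable]: "B \<in> sets (PiM (J k) (\<lambda>_. N))" and c: "0 \<le> c"
  shows "emeasure (P g) {z\<in>space (P g). restrict z (J k) \<in> B}
    \<le> ennreal c * emeasure (Pinf k) B + emeasure (P g) {z\<in>space (P g). c < likr g k (restrict z (J k))}"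
proof -
  let ?C = "{y\<in>space (PiM (J k) (\<lambda>_. N)). c < likr g k y}"
  have C [measurable]: "?C \<in> sets (PiM (J k) (\<lambda>_. N))" by measurable
  have P_obs: "emeasure (P g) {z\<in>space (P g). restrict z (J k) \<in> B'} = (\<integral>\<^sup>+ y. Lik g k y * indicator B' y \<partial>Pinf k)"
    if [measurable]: "B' \<in> sets (PiM (J k) (\<lambda>_. N))" for B'
  proof -
    have "emeasure (P g) {z\<in>space (P g). restrict z (J k) \<in> B'} = (\<integral>\<^sup>+ z. indicator {z\<in>space (P g). restrict z (J k) \<in> B'} z \<partial>P g)"
      by (subst nn_integral_indicator) auto
    also have "\<dots> = (\<integral>\<^sup>+ z. indicator B' (restrict z (J k)) \<partial>P g)"
      by (intro nn_integral_cong) (auto simp: indicator_def)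
    also have "\<dots> = (\<integral>\<^sup>+ y. Lik g k y * indicator B' y \<partial>Pinf k)"
      by (rule nn_integral_P_obs) measurable
    finally show ?thesis .
  qed
  have "emeasure (P g) {z\<in>space (P g). restrict z (J k) \<in> B} = (\<integral>\<^sup>+ y. Lik g k y * indicator B y \<partial>Pinf k)"
    by (rule P_obs[OF B])
  also have "\<dots> \<le> (\<integral>\<^sup>+ y. ennreal c * indicator B y + Lik g k y * indicator ?C y \<partial>Pinf k)"
  proof (intro nn_integral_mono)
    fix y assume "y \<in> space (Pinf k)"
    then have y: "y \<in> space (PiM (J k) (\<lambda>_. N))" by simp
    show "Lik g k y * indicator B y \<le> ennreal c * indicator B y + Lik g k y * indicator ?C y"
      using y by (cases "c < likr g k y") (auto simp: Lik_eq_likr[OF y] indicator_def ennreal_leI)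
  qed
  also have "\<dots> = ennreal c * emeasure (Pinf k) B + (\<integral>\<^sup>+ y. Lik g k y * indicator ?C y \<partial>Pinf k)"
    by (subst nn_integral_add) (auto simp: nn_integral_cmult)
  also have "(\<integral>\<^sup>+ y. Lik g k y * indicator ?C y \<partial>Pinf k) = emeasure (P g) {z\<in>space (P g). restrict z (J k) \<in> ?C}"
    by (rule P_obs[OF C, symmetric])
  also have "{z\<in>space (P g). restrict z (J k) \<in> ?C} = {z\<in>space (P g). c < likr g k (restrict z (J k))}"
    using measurable_space[OF restrict_J_measurable] by auto
  finally show ?thesis .
qed

text \<open>The log-likelihood is a sum over the changed cells, each with mean \<open>D\<close>. All
  change-points are at least \<Gamma>_1, so by time \<Gamma>_1 + \<open>K\<close> - 1 there are at
  most \<open>L * K\<close> such cells, and the uniform weak law supplies one \<open>K0\<close> for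
  all \<open>g\<close>.\<close>

lemma likelihood_growth:
  assumes e: "0 < e" and d: "0 < d"
  obtains K0 :: nat where "\<And>K g. K0 \<le> K \<Longrightarrow> 1 \<le> K \<Longrightarrow> g \<in> set_pmf cp \<Longrightarrow>
    measure (P g) {z\<in>space (P g). exp (real K * (real L * D + e)) < likr g (g 1 + K - 1) (restrict z (J (g 1 + K - 1)))} \<le> d"
proof -
  define Q1 where "Q1 = distr P1 borel (\<lambda>x. ln (lr x))"
  have Q1: "prob_space Q1" "sets Q1 = sets borel" "integrable Q1 (\<lambda>x. x)" and IQ1: "(\<integral>x. x \<partial>Q1) = D"
    using prob_space.prob_space_distr[OF prob_P1, of "\<lambda>x. ln (lr x)" borel] integrable_ln_lr integral_ln_lr
    by (auto simp: Q1_def integrable_distr_eq integral_distr)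
  obtain K0 :: nat where K0: "\<And>K (M :: (nat \<times> nat \<Rightarrow> 'a) measure) (I :: (nat \<times> nat) set) X. K0 \<le> K \<Longrightarrow> prob_space M \<Longrightarrow> finite I \<Longrightarrow> card I \<le> L * K \<Longrightarrow>
     prob_space.indep_vars M (\<lambda>_. borel) X I \<Longrightarrow> (\<And>i. i \<in> I \<Longrightarrow> distr M borel (X i) = Q1) \<Longrightarrow>
     measure M {\<omega>\<in>space M. real (card I) * (\<integral>x. x \<partial>Q1) + e * real K \<le> (\<Sum>i\<in>I. X i \<omega>)} \<le> d"
    using weak_law_uniform[OF Q1 e d, where c=L] by blast
  show ?thesis
  proof (rule that[of K0])
    fix K g assume K: "K0 \<le> K" "1 \<le> K" and g: "g \<in> set_pmf cp"
    interpret prob_space "P g" by (rule prob_P)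
    define k where "k = g 1 + K - 1"
    define I where "I = {i\<in>J k. g (snd i) \<le> fst i}"
    have "I \<subseteq> {g 1..<g 1 + K} \<times> {1..L}"
      using cp_pmf_mono[OF g, of 1] K by (fastforce simp: I_def J_def k_def)
    then have "card I \<le> card ({g 1..<g 1 + K} \<times> {1..L})" by (intro card_mono) auto
    then have cI: "card I \<le> L * K" by (simp add: card_cartesian_product mult.commute)
    have fI: "finite I" by (simp add: I_def)
    have meas [measurable]: "(\<lambda>z. ln (lr (z i))) \<in> borel_measurable (P g)" for i
      by measurable
    have "measure (P g) {z\<in>space (P g). exp (real K * (real L * D + e)) < likr g k (restrict z (J k))}
      \<le> measure (P g) {z\<in>space (P g). real (card I) * (\<integral>x. x \<partial>Q1) + e * real K \<le> (\<Sum>i\<in>I. ln (lr (z i)))}"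
    proof (rule finite_measure_mono_AE)
      show "AE z in P g. z \<in> {z\<in>space (P g). exp (real K * (real L * D + e)) < likr g k (restrict z (J k))} \<longrightarrow>
        z \<in> {z\<in>space (P g). real (card I) * (\<integral>x. x \<partial>Q1) + e * real K \<le> (\<Sum>i\<in>I. ln (lr (z i)))}"
        using AE_lr_pos[of g]
      proof (eventually_elim, intro impI)
        fix z assume pos: "\<forall>i l. g l \<le> i \<longrightarrow> 0 < lr (z (i, l))"
          and z: "z \<in> {z\<in>space (P g). exp (real K * (real L * D + e)) < likr g k (restrict z (J k))}"
        have "likr g k (restrict z (J k)) = (\<Prod>i\<in>I. exp (ln (lr (z i))))"
          unfolding likr_def by (rule prod.mono_neutral_cong_right) (use pos in \<open>auto simp: I_def not_le\<close>)
        also have "\<dots> = exp (\<Sum>i\<in>I. ln (lr (z i)))" by (simp add: exp_sum fI)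
        finally have "real K * (real L * D + e) < (\<Sum>i\<in>I. ln (lr (z i)))" using z by simp
        moreover have "real (card I) * D \<le> real (L * K) * D"
          using cI KL_nonneg by (intro mult_right_mono) (simp_all only: of_nat_le_iff)
        ultimately show "z \<in> {z\<in>space (P g). real (card I) * (\<integral>x. x \<partial>Q1) + e * real K \<le> (\<Sum>i\<in>I. ln (lr (z i)))}"
          using z by (simp add: IQ1 algebra_simps)
      qed
    qed measurable
    also have "\<dots> \<le> d"
    proof (rule K0[OF K(1) prob_P fI cI])
      have "indep_vars (\<lambda>_. borel) (\<lambda>i z. ln (lr (z i))) UNIV"
        by (rule indep_vars_compose2[OF indep_coordinates]) (auto intro!: borel_measurable_ln simp: measurable_cong_sets[OF sets_law refl])
      then show "indep_vars (\<lambda>_. borel) (\<lambda>i z. ln (lr (z i))) I"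
        by (rule indep_vars_subset) simp
      show "distr (P g) borel (\<lambda>z. ln (lr (z i))) = Q1" if "i \<in> I" for i
        using component_changed(1)[of g i "\<lambda>x. ln (lr x)"] that by (simp add: Q1_def I_def)
    qed
    finally show "measure (P g) {z\<in>space (P g). exp (real K * (real L * D + e)) < likr g (g 1 + K - 1) (restrict z (J (g 1 + K - 1)))} \<le> d"
      by (simp add: k_def)
  qed
qed


text \<open>A test that has not stopped by \<Gamma>_1 + \<open>K\<close> - 1 has delay at least
  \<open>K\<close>. The probability of stopping by then is bounded by the change-of-measure term,
  the weak-law error \<open>d\<close> and the probability of \<Gamma>_1 > \<open>G\<close>. In the
  exponent, \<open>K * (L * D + e)\<close> is the likelihood level and (\<Gamma>_1 +
  \<open>K\<close>) * \<open>\<kappa>\<close> comes from \<open>Pinf_early_stop\<close>.\<close>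

lemma EDD_lower:
  assumes e: "0 < e" and d: "0 < d"
  obtains K0 :: nat where "\<And>K G \<alpha> \<tau>. K0 \<le> K \<Longrightarrow> 1 \<le> K \<Longrightarrow> 0 < \<alpha> \<Longrightarrow> \<tau> \<in> Delta L rho N f0 f1 \<alpha> \<Longrightarrow>
    ennreal (real K * (1 - (exp (real K * (rate + e) + real G * \<kappa>) * \<alpha> + d + (1 - rho 1) ^ Suc G))) \<le> EDD L rho N f0 f1 \<tau>"
proof -
  obtain K0 :: nat where K0: "\<And>K g. K0 \<le> K \<Longrightarrow> 1 \<le> K \<Longrightarrow> g \<in> set_pmf cp \<Longrightarrow>
    measure (P g) {z\<in>space (P g). exp (real K * (real L * D + e)) < likr g (g 1 + K - 1) (restrict z (J (g 1 + K - 1)))} \<le> d"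
    using likelihood_growth[OF e d] by blast
  show ?thesis
  proof (rule that[of K0])
    fix K G \<alpha> \<tau> assume K: "K0 \<le> K" "1 \<le> K" and \<alpha>: "0 < \<alpha>" and \<tau>: "\<tau> \<in> Delta L rho N f0 f1 \<alpha>"
    interpret prob_space M by (rule prob_M)
    have stop: "obs_stopping_time L rho N f0 f1 \<tau>" using \<tau> by (auto simp: Delta_def)
    define S where "S = {\<omega>\<in>space M. \<tau> \<omega> \<le> enat (fst \<omega> 1 + K - 1)}"
    have S_sets: "S \<in> sets M"
    proof -
      have "S = (\<Union>j. {\<omega>\<in>space M. fst \<omega> 1 = j} \<inter> {\<omega>\<in>space M. \<tau> \<omega> \<le> enat (j + K - 1)})"
        unfolding S_def by blast
      then show ?thesis using stopping_time_sets(2)[OF stop] sets_M_fst by (auto intro!: sets.countable_UN sets.Int)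
    qed
    then have [measurable]: "S \<in> sets (count_space UNIV \<Otimes>\<^sub>M PiM UNIV (\<lambda>_. N))" by (simp only: sets_M)
    define c where "c = exp (real K * (real L * D + e))"
    define p where "p = exp (real K * (rate + e) + real G * \<kappa>) * \<alpha>"
    have p: "0 \<le> p" using \<alpha> by (simp add: p_def)
    have fiber: "emeasure (P g) {z\<in>space (P g). (g, z) \<in> S} \<le> ennreal (p + d) + indicator {g. Suc G \<le> g 1} g"
      if g: "g \<in> set_pmf cp" for g
    proof (cases "Suc G \<le> g 1")
      case True
      have "emeasure (P g) {z\<in>space (P g). (g, z) \<in> S} \<le> 1"
        using prob_space.emeasure_le_1[OF prob_P] .
      also have "(1::ennreal) \<le> ennreal (p + d) + 1" by simp
      finally show ?thesis using True by simp
    next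
      case False
      define k where "k = g 1 + K - 1"
      have Suc_k: "Suc k = g 1 + K" using K by (simp add: k_def)
      obtain B where B [measurable]: "B \<in> sets (PiM (J k) (\<lambda>_. N))"
        and eq: "{\<omega>\<in>space M. \<tau> \<omega> \<le> enat k} = {\<omega>\<in>space M. obs k \<omega> \<in> B}"
        using stopping_time_sets(1)[OF stop, of k] sets_F_iff by blast
      have "{z\<in>space (P g). (g, z) \<in> S} = {z\<in>space (P g). restrict z (J k) \<in> B}"
      proof -
        have "(g, z) \<in> S \<longleftrightarrow> restrict z (J k) \<in> B" if "z \<in> space (P g)" for z
        proof -
          have z: "(g, z) \<in> space M" using that by simp
          have "(g, z) \<in> S \<longleftrightarrow> (g, z) \<in> {\<omega>\<in>space M. \<tau> \<omega> \<le> enat k}"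
            unfolding S_def k_def by simp
          also have "\<dots> \<longleftrightarrow> (g, z) \<in> {\<omega>\<in>space M. obs k \<omega> \<in> B}" unfolding eq ..
          finally show ?thesis using z by simp
        qed
        then show ?thesis by blast
      qed
      then have "emeasure (P g) {z\<in>space (P g). (g, z) \<in> S}
        \<le> ennreal c * emeasure (Pinf k) B + emeasure (P g) {z\<in>space (P g). c < likr g k (restrict z (J k))}"
        using change_of_measure[OF B, of c g] by (simp add: c_def)
      also have "\<dots> \<le> ennreal p + ennreal d"
      proof (rule add_mono)
        have "ennreal c * emeasure (Pinf k) B \<le> ennreal c * ennreal (exp (real (Suc k) * \<kappa>) * \<alpha>)"
          by (intro mult_left_mono Pinf_early_stop[OF \<tau> B eq]) simp
        also have "\<dots> = ennreal (c * exp (real (Suc k) * \<kappa>) * \<alpha>)"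
          by (simp add: ennreal_mult'[symmetric] c_def mult.assoc)
        also have "\<dots> \<le> ennreal p"
        proof (rule ennreal_leI)
          have "real (g 1) * \<kappa> \<le> real G * \<kappa>" using False kappa_pos by (intro mult_right_mono) auto
          then have "real K * (real L * D + e) + real (Suc k) * \<kappa> \<le> real K * (rate + e) + real G * \<kappa>"
            unfolding Suc_k rate_def by (simp add: algebra_simps)
          then show "c * exp (real (Suc k) * \<kappa>) * \<alpha> \<le> p"
            unfolding c_def p_def exp_add[symmetric] using \<alpha> by (intro mult_right_mono) auto
        qed
        finally show "ennreal c * emeasure (Pinf k) B \<le> ennreal p" .
        show "emeasure (P g) {z\<in>space (P g). c < likr g k (restrict z (J k))} \<le> ennreal d"
          using K0[OF K g] d unfolding c_def k_def
          by (simp add: finite_measure.emeasure_eq_measure[OF prob_space.finite_measure[OF prob_P]] ennreal_leI)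
      qed
      also have "\<dots> = ennreal (p + d)" using p d by simp
      finally show ?thesis using False by simp
    qed
    have "emeasure M S = (\<integral>\<^sup>+ \<omega>. indicator S \<omega> \<partial>M)" using S_sets by (rule nn_integral_indicator[symmetric])
    also have "\<dots> = (\<integral>\<^sup>+ g. (\<integral>\<^sup>+ z. indicator S (g, z) \<partial>P g) \<partial>cp)"
      by (rule nn_integral_M) measurable
    also have "\<dots> = (\<integral>\<^sup>+ g. emeasure (P g) {z\<in>space (P g). (g, z) \<in> S} \<partial>cp)"
    proof (rule nn_integral_cong)
      fix g
      have "(\<integral>\<^sup>+ z. indicator S (g, z) \<partial>P g) = (\<integral>\<^sup>+ z. indicator {z\<in>space (P g). (g, z) \<in> S} z \<partial>P g)"
        by (intro nn_integral_cong) (auto simp: indicator_def)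
      then show "(\<integral>\<^sup>+ z. indicator S (g, z) \<partial>P g) = emeasure (P g) {z\<in>space (P g). (g, z) \<in> S}"
        by (subst (asm) nn_integral_indicator) measurable
    qed
    also have "\<dots> \<le> (\<integral>\<^sup>+ g. ennreal (p + d) + indicator {g. Suc G \<le> g 1} g \<partial>cp)"
      by (intro nn_integral_mono_AE, unfold AE_measure_pmf_iff, intro ballI fiber)
    also have "\<dots> = ennreal (p + d) + ennreal ((1 - rho 1) ^ Suc G)"
      using measure_cp_Gamma1[of "Suc G"]
      by (subst nn_integral_add) (auto simp: measure_pmf.emeasure_eq_measure)
    also have "\<dots> = ennreal (p + d + (1 - rho 1) ^ Suc G)"
      using p d rho1 by (subst ennreal_plus) auto
    finally have "ennreal (prob S) \<le> ennreal (p + d + (1 - rho 1) ^ Suc G)"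
      by (simp add: emeasure_eq_measure)
    then have prob_S: "prob S \<le> p + d + (1 - rho 1) ^ Suc G"
      using p d rho1 by (subst (asm) ennreal_le_iff) auto
    have "ennreal (real K * (1 - (p + d + (1 - rho 1) ^ Suc G))) \<le> ennreal (real K * prob (space M - S))"
      unfolding prob_compl[OF S_sets] using prob_S by (intro ennreal_leI mult_left_mono) (linarith, simp)
    also have "\<dots> = of_nat K * emeasure M (space M - S)"
      by (simp add: emeasure_eq_measure ennreal_mult ennreal_of_nat_eq_real_of_nat)
    also have "\<dots> = (\<integral>\<^sup>+ \<omega>. of_nat K * indicator (space M - S) \<omega> \<partial>M)"
      using S_sets by (intro nn_integral_cmult_indicator[symmetric] sets.compl_sets)
    also have "\<dots> \<le> EDD L rho N f0 f1 \<tau>"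
      unfolding EDD_def
    proof (rule nn_integral_mono)
      fix \<omega> assume \<omega>: "\<omega> \<in> space M"
      show "of_nat K * indicator (space M - S) \<omega> \<le> ennreal_of_enat (\<tau> \<omega> - enat (fst \<omega> 1))"
      proof (cases "\<omega> \<in> S")
        case False
        then have "\<not> \<tau> \<omega> \<le> enat (fst \<omega> 1 + K - 1)" using \<omega> by (simp add: S_def)
        then have "enat K \<le> \<tau> \<omega> - enat (fst \<omega> 1)" using K by (cases "\<tau> \<omega>") auto
        then have "ennreal_of_enat (enat K) \<le> ennreal_of_enat (\<tau> \<omega> - enat (fst \<omega> 1))"
          by (simp only: ennreal_of_enat_le_iff)
        then show ?thesis using False \<omega> by simp
      qed simp
    qed
    finally show "ennreal (real K * (1 - (exp (real K * (rate + e) + real G * \<kappa>) * \<alpha> + d + (1 - rho 1) ^ Suc G))) \<le> EDD L rho N f0 f1 \<tau>"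
      by (simp only: p_def)
  qed
qed

section \<open>Passage to the limits\<close>

abbreviation "level \<alpha> \<equiv> ln (1 / (rho 1 * \<alpha>))"

lemma filterlim_level: "filterlim level at_top (at_right 0)"
  using rho1 by real_asymp

text \<open>With \<open>K\<close> about \<open>(1 - \<delta>) * level \<alpha> / rate\<close> and
  \<open>e = \<delta> * rate\<close>, the product \<open>K * (rate + e)\<close> is about
  \<open>1 - \<delta>\<^sup>2\<close> times the level, so multiplying its exponential by
  \<open>\<alpha>\<close> still gives something that vanishes. One factor
  \<open>1 - \<delta>\<close> is due to \<open>K\<close>, the other to the three errors, each at
  most \<open>\<delta> / 3\<close>.\<close>

lemma EDD_asymp_lower:
  assumes \<delta>: "0 < \<delta>" "\<delta> < 1"
  shows "eventually (\<lambda>\<alpha>. \<forall>\<tau>\<in>Delta L rho N f0 f1 \<alpha>. ennreal ((1 - \<delta>)\<^sup>2 * (level \<alpha> / rate)) \<le> EDD L rho N f0 f1 \<tau>) (at_right 0)"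
proof -
  define e where "e = \<delta> * rate"
  have e: "0 < e" using \<delta> rate_pos by (simp add: e_def)
  have d: "0 < \<delta> / 3" using \<delta> by simp
  obtain K0 :: nat where K0: "\<And>K G \<alpha> \<tau>. K0 \<le> K \<Longrightarrow> 1 \<le> K \<Longrightarrow> 0 < \<alpha> \<Longrightarrow> \<tau> \<in> Delta L rho N f0 f1 \<alpha> \<Longrightarrow>
    ennreal (real K * (1 - (exp (real K * (rate + e) + real G * \<kappa>) * \<alpha> + \<delta> / 3 + (1 - rho 1) ^ Suc G))) \<le> EDD L rho N f0 f1 \<tau>"
    using EDD_lower[OF e d] by blast
  have "(\<lambda>G. (1 - rho 1) ^ Suc G) \<longlonglongrightarrow> 0"
    using rho1 by (intro LIMSEQ_Suc LIMSEQ_realpow_zero) auto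
  then have "eventually (\<lambda>G. (1 - rho 1) ^ Suc G < \<delta> / 3) sequentially"
    using d by (intro order_tendstoD(2))
  then obtain G where G: "(1 - rho 1) ^ Suc G < \<delta> / 3" by (auto simp: eventually_sequentially)
  \<comment> \<open>Collects what does not grow with the level: \<open>rate + e\<close> from
    rounding \<open>K\<close> up, and the cost of \<Gamma>_1 up to \<open>G\<close>.\<close>
  define C where "C = rate + e + real G * \<kappa>"
  have "((\<lambda>a. exp (C - \<delta>\<^sup>2 * a) / rho 1) \<longlongrightarrow> 0) at_top"
    using \<delta> rho1 by real_asymp
  then have "eventually (\<lambda>a. exp (C - \<delta>\<^sup>2 * a) / rho 1 < \<delta> / 3) at_top"
    using d by (intro order_tendstoD(2))
  moreover have "eventually (\<lambda>a. real K0 + 1 \<le> (1 - \<delta>) * a / rate) at_top"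
    using eventually_ge_at_top[of "(real K0 + 1) * rate / (1 - \<delta>)"]
    by eventually_elim (use \<delta> rate_pos in \<open>simp add: field_simps\<close>)
  ultimately have "eventually (\<lambda>a. exp (C - \<delta>\<^sup>2 * a) / rho 1 < \<delta> / 3 \<and> real K0 + 1 \<le> (1 - \<delta>) * a / rate) at_top"
    by (rule eventually_conj)
  then have "eventually (\<lambda>\<alpha>. exp (C - \<delta>\<^sup>2 * level \<alpha>) / rho 1 < \<delta> / 3 \<and> real K0 + 1 \<le> (1 - \<delta>) * level \<alpha> / rate) (at_right 0)"
    using filterlim_level by (rule eventually_compose_filterlim)
  moreover have "eventually (\<lambda>\<alpha>::real. 0 < \<alpha>) (at_right 0)" by (rule eventually_at_right_less)
  ultimately show ?thesis
  proof (eventually_elim, intro ballI)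
    fix \<alpha> \<tau> assume *: "exp (C - \<delta>\<^sup>2 * level \<alpha>) / rho 1 < \<delta> / 3 \<and> real K0 + 1 \<le> (1 - \<delta>) * level \<alpha> / rate"
      and \<alpha>: "0 < \<alpha>" and \<tau>: "\<tau> \<in> Delta L rho N f0 f1 \<alpha>"
    define a where "a = level \<alpha>"
    define K where "K = nat \<lceil>(1 - \<delta>) * a / rate\<rceil>"
    have ar: "real K0 + 1 \<le> (1 - \<delta>) * a / rate" using * by (simp add: a_def)
    have K_ge: "(1 - \<delta>) * a / rate \<le> real K" unfolding K_def by linarith
    have K_le: "real K \<le> (1 - \<delta>) * a / rate + 1" unfolding K_def using ar by linarith
    have K: "K0 \<le> K" "1 \<le> K" using K_ge ar by linarith+
    have exp_a: "\<alpha> = exp (- a) / rho 1"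
      using \<alpha> rho1 by (simp add: a_def ln_div exp_minus)
    have "exp (real K * (rate + e) + real G * \<kappa>) * \<alpha> \<le> exp (C - \<delta>\<^sup>2 * a) / rho 1"
    proof -
      have "real K * (rate + e) \<le> ((1 - \<delta>) * a / rate + 1) * (rate + e)"
        using K_le e rate_pos by (intro mult_right_mono) auto
      also have "\<dots> = a - \<delta>\<^sup>2 * a + rate + e"
        using rate_pos by (simp add: e_def field_simps power2_eq_square)
      finally have "real K * (rate + e) + real G * \<kappa> - a \<le> C - \<delta>\<^sup>2 * a" by (simp add: C_def)
      then have "exp (real K * (rate + e) + real G * \<kappa> - a) / rho 1 \<le> exp (C - \<delta>\<^sup>2 * a) / rho 1"
        using rho1 by (intro divide_right_mono) auto
      then show ?thesis by (simp add: exp_a exp_diff exp_minus divide_simps)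
    qed
    then have small: "exp (real K * (rate + e) + real G * \<kappa>) * \<alpha> + \<delta> / 3 + (1 - rho 1) ^ Suc G \<le> \<delta>"
      using conjunct1[OF *] G unfolding a_def by linarith
    have "ennreal ((1 - \<delta>)\<^sup>2 * (a / rate)) = ennreal (((1 - \<delta>) * a / rate) * (1 - \<delta>))"
      by (simp add: power2_eq_square mult_ac)
    also have "\<dots> \<le> ennreal (real K * (1 - (exp (real K * (rate + e) + real G * \<kappa>) * \<alpha> + \<delta> / 3 + (1 - rho 1) ^ Suc G)))"
    proof (intro ennreal_leI mult_mono)
      show "1 - \<delta> \<le> 1 - (exp (real K * (rate + e) + real G * \<kappa>) * \<alpha> + \<delta> / 3 + (1 - rho 1) ^ Suc G)"
        using small by linarith
    qed (use K_ge \<delta> in auto)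
    also have "\<dots> \<le> EDD L rho N f0 f1 \<tau>" by (rule K0[OF K \<alpha> \<tau>])
    finally show "ennreal ((1 - \<delta>)\<^sup>2 * (level \<alpha> / rate)) \<le> EDD L rho N f0 f1 \<tau>" by (simp only: a_def)
  qed
qed


text \<open>Any bound \<open>r > 1 / rate\<close> leaves room for a \<open>c'\<close> with
  \<open>1 / r < c' < rate\<close>; the additive constant disappears on division by the
  level.\<close>

lemma Limsup_nu:
  "Limsup at_top (\<lambda>A. (\<integral>\<^sup>+ \<omega>. ennreal_of_enat (\<nu> A \<omega>) \<partial>M) / ennreal A) \<le> ennreal (1 / rate)"
  unfolding Limsup_le_iff
proof (intro allI impI)
  fix y :: ennreal assume "ennreal (1 / rate) < y"
  then obtain r' where r': "ennreal (1 / rate) < r'" "r' < y" using dense by blast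
  then obtain r where r: "r' = ennreal r" "0 \<le> r" by (cases r') auto
  have r1: "1 / rate < r" using r' r rate_pos by (simp add: ennreal_less_iff)
  then have r0: "0 < r" using rate_pos by (meson less_trans zero_less_divide_1_iff)
  have "1 / r < rate" using r1 r0 rate_pos by (simp add: field_simps)
  then obtain c' where c': "1 / r < c'" "c' < rate" using dense by blast
  have c'0: "0 < c'" using c' r0 by (meson less_trans zero_less_divide_1_iff)
  have c'r: "1 / c' < r" using c' c'0 r0 by (simp add: field_simps)
  obtain K where K: "0 \<le> K" "\<And>A. 0 \<le> A \<Longrightarrow> (\<integral>\<^sup>+ \<omega>. ennreal_of_enat (\<nu> A \<omega>) \<partial>M) \<le> ennreal (K + A / c')"
    using nn_integral_nu_le[OF c'0 c'(2)] by blast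
  have "((\<lambda>A. (K + A / c') / A) \<longlongrightarrow> inverse c') at_top" using c'0 by real_asymp
  then have "((\<lambda>A. (K + A / c') / A) \<longlongrightarrow> 1 / c') at_top" by (simp only: inverse_eq_divide)
  then have "eventually (\<lambda>A. (K + A / c') / A < r) at_top" using c'r by (rule order_tendstoD(2))
  then show "eventually (\<lambda>A. (\<integral>\<^sup>+ \<omega>. ennreal_of_enat (\<nu> A \<omega>) \<partial>M) / ennreal A < y) at_top"
    using eventually_gt_at_top[of 0]
  proof eventually_elim
    case (elim A)
    have "(\<integral>\<^sup>+ \<omega>. ennreal_of_enat (\<nu> A \<omega>) \<partial>M) / ennreal A \<le> ennreal (K + A / c') / ennreal A"
      using K(2)[of A] elim by (intro divide_right_mono_ennreal) auto
    also have "\<dots> = ennreal ((K + A / c') / A)" using K(1) elim c'0 by (intro divide_ennreal) auto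
    also have "\<dots> \<le> r'" unfolding r using elim by (intro ennreal_leI) simp
    finally show ?case using r' by simp
  qed
qed

text \<open>Dropping \<Gamma>_1 costs at most its finite mean, which is negligible against the
  growing level.\<close>

lemma EDD_le: "EDD L rho N f0 f1 \<tau> \<le> (\<integral>\<^sup>+ \<omega>. ennreal_of_enat (\<tau> \<omega>) \<partial>M)"
  unfolding EDD_def
proof (rule nn_integral_mono)
  fix \<omega>
  have "x - enat n \<le> x" for x n by (cases x) auto
  then show "ennreal_of_enat (\<tau> \<omega> - enat (fst \<omega> 1)) \<le> ennreal_of_enat (\<tau> \<omega>)"
    by (simp only: ennreal_of_enat_le_iff)
qed

text \<open>For \<open>\<alpha> < 1\<close> the numerator
  \<open>ln (1 / rho 1) + |ln \<alpha>|\<close> is exactly the level, so \<open>Limsup_nu\<close> is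
  composed with \<open>level\<close>, which tends to infinity.\<close>

lemma Limsup_EDD:
  "Limsup (at_right 0) (\<lambda>\<alpha>. EDD L rho N f0 f1 (\<nu> (level \<alpha>)) / ennreal ((ln (1 / rho 1) + \<bar>ln \<alpha>\<bar>) / rate)) \<le> 1"
  unfolding Limsup_le_iff
proof (intro allI impI)
  fix y :: ennreal assume y: "1 < y"
  define X where "X A = (\<integral>\<^sup>+ \<omega>. ennreal_of_enat (\<nu> A \<omega>) \<partial>M)" for A
  have rate: "ennreal (1 / rate) * ennreal rate = 1"
    using rate_pos by (simp add: ennreal_mult'[symmetric])
  have "ennreal (1 / rate) < y * ennreal (1 / rate)"
    using ennreal_mult_strict_right_mono[OF y, of "ennreal (1 / rate)"] rate_pos by simp
  then have "eventually (\<lambda>A. X A / ennreal A < y * ennreal (1 / rate)) at_top"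
    using Limsup_nu unfolding Limsup_le_iff X_def by blast
  then have "eventually (\<lambda>A. X A / ennreal A < y * ennreal (1 / rate) \<and> 0 < A) at_top"
    using eventually_gt_at_top[of 0] by (rule eventually_conj)
  then have "eventually (\<lambda>\<alpha>. X (level \<alpha>) / ennreal (level \<alpha>) < y * ennreal (1 / rate) \<and> 0 < level \<alpha>) (at_right 0)"
    using filterlim_level by (rule eventually_compose_filterlim)
  moreover have "eventually (\<lambda>\<alpha>::real. \<alpha> \<in> {0<..<1}) (at_right 0)" by (rule eventually_at_right_real) simp
  ultimately show "eventually (\<lambda>\<alpha>. EDD L rho N f0 f1 (\<nu> (level \<alpha>)) / ennreal ((ln (1 / rho 1) + \<bar>ln \<alpha>\<bar>) / rate) < y) (at_right 0)"
  proof eventually_elim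
    case (elim \<alpha>)
    have level: "ln (1 / rho 1) + \<bar>ln \<alpha>\<bar> = level \<alpha>"
      using elim rho1 by (simp add: ln_div ln_mult)
    have "EDD L rho N f0 f1 (\<nu> (level \<alpha>)) / ennreal (level \<alpha> / rate) \<le> X (level \<alpha>) / ennreal (level \<alpha> / rate)"
      unfolding X_def by (intro divide_right_mono_ennreal EDD_le)
    also have "\<dots> = X (level \<alpha>) / ennreal (level \<alpha>) * ennreal rate"
    proof -
      have "x / ennreal (a / r) = x / ennreal a * ennreal r" if "0 < a" "0 < r" for x :: ennreal and a r :: real
      proof -
        have "inverse (ennreal (a / r)) = inverse (ennreal a) * ennreal r"
          using that by (simp add: inverse_ennreal ennreal_mult'[symmetric] divide_inverse mult.commute)
        then show ?thesis by (simp add: divide_ennreal_def mult.assoc)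
      qed
      then show ?thesis using elim rate_pos by blast
    qed
    also have "\<dots> < y * ennreal (1 / rate) * ennreal rate"
      using elim rate_pos by (intro ennreal_mult_strict_right_mono) auto
    also have "\<dots> = y" by (simp add: mult.assoc rate)
    finally show ?case unfolding level .
  qed
qed

lemma Liminf_EDD:
  "1 \<le> Liminf (at_right 0) (\<lambda>\<alpha>. (INF \<tau>\<in>Delta L rho N f0 f1 \<alpha>. EDD L rho N f0 f1 \<tau>) / ennreal (level \<alpha> / rate))"
  unfolding le_Liminf_iff
proof (intro allI impI)
  fix y :: ennreal assume y: "y < 1"
  then obtain r where r: "y = ennreal r" "0 \<le> r" by (cases y) auto
  have r1: "r < 1" using y r by (simp add: ennreal_less_one_iff)
  \<comment> \<open>This makes \<open>1 - 2 * \<delta>\<close> the midpoint of \<open>r\<close> and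
    1, which leaves \<open>(1 - \<delta>)\<^sup>2\<close> strictly above \<open>r\<close>.\<close>
  define \<delta> where "\<delta> = (1 - r) / 4"
  have \<delta>: "0 < \<delta>" "\<delta> < 1" using r r1 by (auto simp: \<delta>_def)
  have "1 - 2 * \<delta> \<le> (1 - \<delta>)\<^sup>2" by (simp add: power2_eq_square algebra_simps)
  moreover have "r < 1 - 2 * \<delta>" using r1 unfolding \<delta>_def by (simp add: field_simps)
  ultimately have r\<delta>: "r < (1 - \<delta>)\<^sup>2" by linarith
  have "eventually (\<lambda>\<alpha>. 0 < level \<alpha>) (at_right 0)"
    using filterlim_level eventually_gt_at_top by (rule filterlim_iff[THEN iffD1, rule_format])
  with EDD_asymp_lower[OF \<delta>]
  show "eventually (\<lambda>\<alpha>. y < (INF \<tau>\<in>Delta L rho N f0 f1 \<alpha>. EDD L rho N f0 f1 \<tau>) / ennreal (level \<alpha> / rate)) (at_right 0)"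
  proof eventually_elim
    case (elim \<alpha>)
    have pos: "0 < level \<alpha> / rate" using elim rate_pos by simp
    have "ennreal ((1 - \<delta>)\<^sup>2 * (level \<alpha> / rate)) \<le> (INF \<tau>\<in>Delta L rho N f0 f1 \<alpha>. EDD L rho N f0 f1 \<tau>)"
      using elim by (intro INF_greatest) blast
    then have "ennreal ((1 - \<delta>)\<^sup>2 * (level \<alpha> / rate)) / ennreal (level \<alpha> / rate)
      \<le> (INF \<tau>\<in>Delta L rho N f0 f1 \<alpha>. EDD L rho N f0 f1 \<tau>) / ennreal (level \<alpha> / rate)"
      by (rule divide_right_mono_ennreal)
    moreover have "ennreal ((1 - \<delta>)\<^sup>2 * (level \<alpha> / rate)) / ennreal (level \<alpha> / rate) = ennreal ((1 - \<delta>)\<^sup>2)"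
    proof -
      have "ennreal (a * x) / ennreal x = ennreal a" if "0 \<le> a" "0 < x" for a x :: real
        using that by (simp add: divide_ennreal)
      from this[OF zero_le_power2 pos] show ?thesis .
    qed
    moreover have "y < ennreal ((1 - \<delta>)\<^sup>2)" using r r\<delta> by (simp add: ennreal_less_iff)
    ultimately show ?case by simp
  qed
qed

end

theorem theorem3:
  fixes L :: nat and rho :: "nat \<Rightarrow> real"
    and N :: "'a measure" and f0 f1 :: "'a \<Rightarrow> real"
  assumes L: "L \<ge> 1"
    and rho: "\<And>l. l \<in> {1..L} \<Longrightarrow> 0 < rho l \<and> rho l < 1"
    and f0_meas: "f0 \<in> borel_measurable N" and f1_meas: "f1 \<in> borel_measurable N"
    and f0_nonneg: "\<And>x. x \<in> space N \<Longrightarrow> 0 \<le> f0 x"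
    and f1_nonneg: "\<And>x. x \<in> space N \<Longrightarrow> 0 \<le> f1 x"
    and f0_dens: "(\<integral>\<^sup>+ x. ennreal (f0 x) \<partial>N) = 1"
    and f1_dens: "(\<integral>\<^sup>+ x. ennreal (f1 x) \<partial>N) = 1"
    and mutual_ac: "AE x in N. (0 < f0 x \<longleftrightarrow> 0 < f1 x)"
    and D_finite: "integrable N (\<lambda>x. f1 x * ln (f1 x / f0 x))"
    and detect: "\<And>l. l \<in> {2..L} \<Longrightarrow> \<exists>j\<in>{l..L}.
         KL N f1 f0 > 1 / real (j - l + 1) *
           ln ((\<Sum>p=0..l-1. 1 - rho_pp L rho p) / (1 - rho_pp L rho j))"
  defines "M \<equiv> model L rho N f0 f1"
    and "c \<equiv> real L * KL N f1 f0 + \<bar>ln (1 - rho 1)\<bar>"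
    and "Aof \<equiv> (\<lambda>\<alpha>::real. ln (1 / (rho 1 * \<alpha>)))"
  shows "Limsup at_top (\<lambda>A::real. (\<integral>\<^sup>+ \<omega>. ennreal_of_enat (nu L rho N f0 f1 A \<omega>) \<partial>M) / ennreal A)
           \<le> ennreal (1 / c)
       \<and> (\<forall>\<alpha>. 0 < \<alpha> \<and> \<alpha> < 1 \<longrightarrow> nu L rho N f0 f1 (Aof \<alpha>) \<in> Delta L rho N f0 f1 \<alpha>)
       \<and> Limsup (at_right 0) (\<lambda>\<alpha>. EDD L rho N f0 f1 (nu L rho N f0 f1 (Aof \<alpha>))
           / ennreal ((ln (1 / rho 1) + \<bar>ln \<alpha>\<bar>) / c)) \<le> 1
       \<and> Liminf (at_right 0) (\<lambda>\<alpha>. (INF \<tau>\<in>Delta L rho N f0 f1 \<alpha>. EDD L rho N f0 f1 \<tau>)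
           / ennreal (ln (1 / (rho 1 * \<alpha>)) / c)) \<ge> 1"
proof -
  interpret multistream L rho N f0 f1
    by (rule multistream.intro) (fact assms)+
  have c: "c = rate"
    using kappa_pos by (simp add: c_def rate_def \<kappa>_def)
  show ?thesis
    unfolding M_def c Aof_def
    using Limsup_nu nu_in_Delta Limsup_EDD Liminf_EDD by blast
qed

end
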